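(* Let $p=6$ and $\alpha>0$. Then $$\mathcal{F}(\mu)=\begin{cases}0 & \text{if } 0<\mu\leq\frac{\sqrt3\,\pi}{4},\\ -\infty & \text{if }\mu>\frac{\sqrt3\,\pi}{4},\end{cases}$$ and ground states of $F$ at mass $\mu$ do not exist for any $\mu>0$.
   Context: Let $\mathbb{R}^+=(0,+\infty)$. For $p\in(2,6]$ and $\alpha\in\mathbb{R}$, the energy is $$F(u)=\frac12\int_0^{+\infty}|u'|^2\,dx-\frac1p\int_0^{+\infty}|u|^p\,dx+\frac{\alpha}{2}|u(0)|^2,\qquad u\in H^1(\mathbb{R}^+),$$ where $u(0)$ is the value at $0$ of the continuous representative of $u$. For $\mu>0$, $H^1_\mu(\mathbb{R}^+):=\{u\in H^1(\mathbb{R}^+):\int_0^{+\infty}|u|^2\,dx=\mu\}$ and $\mathcal{F}(\mu):=\inf_{u\in H^1_\mu(\mathbb{R}^+)}F(u)$. A ground state of $F$ at mass $\mu$ is a function $u\in H^1_\mu(\mathbb{R}^+)$ with $F(u)=\mathcal{F}(\mu)$. Functions are real-valued (this is not restrictive). *)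

theory Defs
  imports "HOL-Analysis.Analysis"
begin

(* Elements of L^2(0,+oo) and H^1(0,+oo) are represented by functions on the whole line of which
   only the restriction to the open half-line matters; no quotient by a.e. equality is taken. All
   quantities defined below are invariant under a.e. equality on the half-line. *)

definition L2_halfline :: "(real \<Rightarrow> real) set" where
  "L2_halfline = {u. set_borel_measurable lebesgue {0<..} u \<and>
                     set_integrable lebesgue {0<..} (\<lambda>x. \<bar>u x\<bar>\<^sup>2)}"

(* C^1_c(0,+oo), extended by 0 to the whole line. *)
definition test_functions :: "(real \<Rightarrow> real) set" where
  "test_functions = {\<phi>. \<phi> C1_differentiable_on UNIV \<and>
                        (\<exists>K. compact K \<and> K \<subseteq> {0<..} \<and> (\<forall>x. x \<notin> K \<longrightarrow> \<phi> x = 0))}"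

(* Weak derivative in the sense of Sobolev spaces on an interval (Brezis, Functional Analysis,
   Sobolev Spaces and PDEs, Section 8.2, where the test functions are C^1_c). *)
definition has_weak_derivative :: "(real \<Rightarrow> real) \<Rightarrow> (real \<Rightarrow> real) \<Rightarrow> bool" where
  "has_weak_derivative u v \<longleftrightarrow>
     (\<forall>\<phi>\<in>test_functions.
        (LINT x:{0<..}|lebesgue. u x * deriv \<phi> x) = - (LINT x:{0<..}|lebesgue. v x * \<phi> x))"

definition H1_halfline :: "(real \<Rightarrow> real) set" where
  "H1_halfline = {u \<in> L2_halfline. \<exists>v\<in>L2_halfline. has_weak_derivative u v}"

(* Determined up to a.e. equality for u in H^1. *)
definition weak_derivative :: "(real \<Rightarrow> real) \<Rightarrow> real \<Rightarrow> real" where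
  "weak_derivative u = (SOME v. v \<in> L2_halfline \<and> has_weak_derivative u v)"

(* For u in H^1 a representative continuous up to the boundary point 0 exists, and it is unique as
   a function on [0,+oo). The raw value u 0 is irrelevant. *)
definition continuous_representative :: "(real \<Rightarrow> real) \<Rightarrow> real \<Rightarrow> real" where
  "continuous_representative u =
     (SOME g. continuous_on {0..} g \<and> (AE x in lebesgue. x > 0 \<longrightarrow> g x = u x))"

definition energy :: "real \<Rightarrow> real \<Rightarrow> (real \<Rightarrow> real) \<Rightarrow> real" where
  "energy p \<alpha> u =
     1 / 2 * (LINT x:{0<..}|lebesgue. \<bar>weak_derivative u x\<bar>\<^sup>2)
     - 1 / p * (LINT x:{0<..}|lebesgue. \<bar>u x\<bar> powr p)
     + \<alpha> / 2 * \<bar>continuous_representative u 0\<bar>\<^sup>2"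

definition H1_mass :: "real \<Rightarrow> (real \<Rightarrow> real) set" where
  "H1_mass \<mu> = {u \<in> H1_halfline. (LINT x:{0<..}|lebesgue. \<bar>u x\<bar>\<^sup>2) = \<mu>}"

definition ground_energy :: "real \<Rightarrow> real \<Rightarrow> real \<Rightarrow> ereal" where
  "ground_energy p \<alpha> \<mu> = (INF u\<in>H1_mass \<mu>. ereal (energy p \<alpha> u))"

definition is_ground_state :: "real \<Rightarrow> real \<Rightarrow> real \<Rightarrow> (real \<Rightarrow> real) \<Rightarrow> bool" where
  "is_ground_state p \<alpha> \<mu> u \<longleftrightarrow>
     u \<in> H1_mass \<mu> \<and> ereal (energy p \<alpha> u) = ground_energy p \<alpha> \<mu>"

end

theory Submission
  imports Defs
begin

text \<open>For \<open>u\<close> in \<open>H\<^sup>1\<close> of mass \<open>\<mu>\<close> let \<open>M x\<close> be the mass of \<open>u\<close> on \<open>{x..}\<close>. The function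
  \<open>u\<^sup>4 \<beta> tan (4 \<beta> (M - c))\<close> is a calibration: its derivative is at most \<open>u'\<^sup>2 - 4 \<beta>\<^sup>2 u\<^sup>6\<close>, and it is defined
  on the whole half-line as long as \<open>4 \<beta> c\<close> and \<open>4 \<beta> (\<mu> - c)\<close> are less than \<open>\<pi>/2\<close>. The choice
  \<open>c = \<mu>\<close> kills the boundary term at 0 and yields the sharp inequality
  \<open>\<pi>\<^sup>2/(16 \<mu>\<^sup>2) \<integral>u\<^sup>6 \<le> \<integral>u'\<^sup>2\<close>, so that the energy without the point interaction is nonnegative exactly up to the
  critical mass. If \<open>u 0 = 0\<close> the boundary term vanishes anyway, and \<open>c = \<mu>/2\<close> improves the
  constant by a factor 4. Hence the energy is strictly positive at or below the critical mass: either
  the point interaction or the improved constant contributes. The rescaled solitons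
  \<open>A / sqrt (cosh (k x))\<close> of mass \<open>\<mu>\<close> have energy \<open>k\<^sup>2 C + k D\<close> with \<open>C < 0\<close> precisely above the critical
  mass, and the limits \<open>k \<rightarrow> 0\<close> and \<open>k \<rightarrow> \<infinity>\<close> give the infimum.\<close>

section \<open>Locally absolutely continuous functions on the half-line\<close>

text \<open>Integration by parts for two indefinite integrals: the diagonal cuts the plane into the
  triangles \<open>s \<le> t\<close> and \<open>t \<le> s\<close>. Fubini turns each summand on the
  left into the integral of \<open>a t * b s\<close> over one triangle, and the two overlap only in
  the diagonal, a null set.\<close>

lemma Fubini_triangles:
  fixes a b :: "real \<Rightarrow> real"
  assumes a: "integrable lborel a" and b: "integrable lborel b"
  defines "A \<equiv> \<lambda>t. LINT s|lborel. indicator {..t} s * a s"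
    and "B \<equiv> \<lambda>t. LINT s|lborel. indicator {..t} s * b s"
  shows "integrable lborel (\<lambda>t. a t * B t)" "integrable lborel (\<lambda>t. b t * A t)"
    and "(LINT t|lborel. a t * B t) + (LINT t|lborel. b t * A t)
           = (LINT t|lborel. a t) * (LINT t|lborel. b t)"
proof -
  have [measurable]: "a \<in> borel_measurable lborel" "b \<in> borel_measurable lborel"
    using a b by auto
  have prod: "integrable (lborel \<Otimes>\<^sub>M lborel) (\<lambda>(t, s). a t * b s)"
  proof (rule lborel_pair.Fubini_integrable)
    show "integrable lborel (\<lambda>t. LINT s|lborel. norm (case (t, s) of (t, s) \<Rightarrow> a t * b s))"
      using a by (simp add: abs_mult)
  qed (use b in auto)
  have i1: "integrable (lborel \<Otimes>\<^sub>M lborel) (\<lambda>(t, s). indicator {..t} s * (a t * b s))"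
    by (rule Bochner_Integration.integrable_bound[OF prod])
       (auto simp: indicator_def split: prod.splits)
  have i2: "integrable (lborel \<Otimes>\<^sub>M lborel) (\<lambda>(t, s). indicator {..s} t * (a t * b s))"
    by (rule Bochner_Integration.integrable_bound[OF prod])
       (auto simp: indicator_def split: prod.splits)
  have aB: "a t * B t = (LINT s|lborel. indicator {..t} s * (a t * b s))" for t
    unfolding B_def by (subst integral_mult_right_zero[symmetric]) (simp add: mult.left_commute)
  have bA: "b s * A s = (LINT t|lborel. indicator {..s} t * (a t * b s))" for s
    unfolding A_def by (subst integral_mult_right_zero[symmetric]) (simp add: mult_ac)
  show "integrable lborel (\<lambda>t. a t * B t)"
    unfolding aB using lborel_pair.integrable_fst'[OF i1] by simp
  show int2: "integrable lborel (\<lambda>t. b t * A t)"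
    unfolding bA using lborel_pair.integrable_snd[OF i2] by simp
  have int3: "integrable lborel (\<lambda>t. LINT s|lborel. indicator {..s} t * (a t * b s))"
    using lborel_pair.integrable_fst'[OF i2] by simp
  have "(LINT t|lborel. a t * B t) + (LINT t|lborel. b t * A t)
      = (LINT t|lborel. a t * B t) + (LINT t|lborel. LINT s|lborel. indicator {..s} t * (a t * b s))"
    unfolding bA using lborel_pair.Fubini_integral[OF i2] by simp
  also have "\<dots> = (LINT t|lborel. (LINT s|lborel. indicator {..t} s * (a t * b s))
                        + (LINT s|lborel. indicator {..s} t * (a t * b s)))"
    using \<open>integrable lborel (\<lambda>t. a t * B t)\<close> int3
    by (subst Bochner_Integration.integral_add) (simp_all add: aB)
  also have "\<dots> = (LINT t|lborel. a t * (LINT s|lborel. b s))"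
  proof (rule Bochner_Integration.integral_cong[OF refl])
    fix t
    have bt: "integrable lborel (\<lambda>s. a t * b s)" using b by simp
    have j1: "integrable lborel (\<lambda>s. indicator {..t} s * (a t * b s))"
      by (rule Bochner_Integration.integrable_bound[OF bt]) (auto simp: indicator_def)
    have j2: "integrable lborel (\<lambda>s. indicator {..s} t * (a t * b s))"
      by (rule Bochner_Integration.integrable_bound[OF bt]) (auto simp: indicator_def)
    have "(LINT s|lborel. indicator {..t} s * (a t * b s)) + (LINT s|lborel. indicator {..s} t * (a t * b s))
        = (LINT s|lborel. indicator {..t} s * (a t * b s) + indicator {..s} t * (a t * b s))"
      using j1 j2 by simp
    also have "\<dots> = (LINT s|lborel. a t * b s)"
    proof (rule integral_cong_AE)
      show "AE s in lborel. indicator {..t} s * (a t * b s) + indicator {..s} t * (a t * b s) = a t * b s"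
        using AE_lborel_singleton[of t] by eventually_elim (auto simp: indicator_def)
    qed (use j1 j2 bt in auto)
    finally show "(LINT s|lborel. indicator {..t} s * (a t * b s))
        + (LINT s|lborel. indicator {..s} t * (a t * b s)) = a t * (LINT s|lborel. b s)" by simp
  qed
  finally show "(LINT t|lborel. a t * B t) + (LINT t|lborel. b t * A t)
           = (LINT t|lborel. a t) * (LINT t|lborel. b t)" by simp
qed

text \<open>Local absolute continuity of \<open>f\<close> on the closed half-line with derivative \<open>v\<close>, phrased
  without reference to pointwise differentiability.\<close>
definition ac_deriv :: "(real \<Rightarrow> real) \<Rightarrow> (real \<Rightarrow> real) \<Rightarrow> bool" where
  "ac_deriv f v \<longleftrightarrow>
     (\<forall>R\<ge>0. set_integrable lebesgue {0..R} v \<and> f R = f 0 + (LINT t:{0..R}|lebesgue. v t))"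

lemma ac_derivD:
  assumes "ac_deriv f v" "R \<ge> 0"
  shows "set_integrable lebesgue {0..R} v" "f R = f 0 + (LINT t:{0..R}|lebesgue. v t)"
    "f R = f 0 + integral {0..R} v"
proof -
  show *: "set_integrable lebesgue {0..R} v" "f R = f 0 + (LINT t:{0..R}|lebesgue. v t)"
    using assms unfolding ac_deriv_def by blast+
  show "f R = f 0 + integral {0..R} v"
    using *(2) unfolding set_lebesgue_integral_eq_integral(2)[OF *(1)] .
qed

lemma ac_deriv_continuous_on:
  assumes "ac_deriv f v"
  shows "continuous_on {0..R} f"
proof (cases "R \<ge> 0")
  case True
  have "v integrable_on {0..R}"
    using ac_derivD(1)[OF assms True] set_lebesgue_integral_eq_integral(1) by blast
  then have "continuous_on {0..R} (\<lambda>x. f 0 + integral {0..x} v)"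
    by (intro continuous_intros indefinite_integral_continuous_1)
  then show ?thesis
    by (rule continuous_on_eq) (metis ac_derivD(3)[OF assms] atLeastAtMost_iff)
qed auto

lemma continuous_on_halflineI:
  fixes f :: "real \<Rightarrow> real"
  assumes "\<And>R. continuous_on {0..R} f"
  shows "continuous_on {0..} f"
proof -
  have "continuous (at x within {0..}) f" if "x \<ge> 0" for x
  proof -
    have "continuous (at x within {0..x+1}) f"
      using assms[of "x+1"] that by (auto simp: continuous_on_eq_continuous_within)
    moreover have "at x within {0..x+1} = at x within {0..}"
      by (rule at_within_nhd[of x "{..<x+1}"]) (use that in auto)
    ultimately show ?thesis by simp
  qed
  then show ?thesis by (auto simp: continuous_on_eq_continuous_within)
qed

text \<open>Transfers to \<open>lborel\<close>, where \<open>Fubini_triangles\<close> is stated: a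
  function integrable for the completed measure is cut off to \<open>{0..R}\<close> and replaced by
  a Borel function equal to it almost everywhere, with the same indefinite integral on
  \<open>{0..R}\<close>.\<close>

lemma lborel_representative:
  fixes v :: "real \<Rightarrow> real"
  assumes "set_integrable lebesgue {0..R} v"
  obtains v' where "integrable lborel v'"
    "AE t in lebesgue. v' t = indicator {0..R} t * v t"
    "\<And>x. 0 \<le> x \<Longrightarrow> x \<le> R \<Longrightarrow> (LINT t|lborel. indicator {..x} t * v' t) = (LINT t:{0..x}|lebesgue. v t)"
    "(LINT t|lborel. v' t) = (LINT t:{0..R}|lebesgue. v t)"
proof -
  have int: "integrable lebesgue (\<lambda>t. indicator {0..R} t * v t)"
    using assms by (simp add: set_integrable_def)
  then obtain v' where v'[measurable]: "v' \<in> borel_measurable lborel"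
    and ae: "AE t in lborel. indicator {0..R} t * v t = v' t"
    using completion_ex_borel_measurable_real borel_measurable_integrable by blast
  have ae': "AE t in lebesgue. indicator {0..R} t * v t = v' t"
    using ae by (rule AE_completion)
  have v'm: "v' \<in> borel_measurable lebesgue" by (simp add: measurable_completion)
  have i: "integrable lebesgue v'"
    using integrable_cong_AE_imp[OF int v'm] ae' by blast
  then have i': "integrable lborel v'" by (simp add: integrable_completion)
  show thesis
  proof
    show "integrable lborel v'" by fact
    show "AE t in lebesgue. v' t = indicator {0..R} t * v t" using ae' by eventually_elim simp
    fix x assume x: "0 \<le> x" "x \<le> R"
    have si: "set_integrable lebesgue {0..x} v"
      by (rule set_integrable_subset[OF assms]) (use x in auto)
    have "(LINT t|lborel. indicator {..x} t * v' t) = (LINT t|lebesgue. indicator {..x} t * v' t)"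
      by (rule integral_completion[symmetric]) simp
    also have "\<dots> = (LINT t|lebesgue. indicator {0..x} t * v t)"
    proof (rule integral_cong_AE)
      show "AE t in lebesgue. indicator {..x} t * v' t = indicator {0..x} t * v t"
        using ae' by eventually_elim (use x in \<open>auto simp: indicator_def split: if_splits\<close>)
      show "(\<lambda>t. indicator {..x} t * v' t) \<in> borel_measurable lebesgue"
        by (rule measurable_completion) simp
      show "(\<lambda>t. indicator {0..x} t * v t) \<in> borel_measurable lebesgue"
        using si by (simp add: set_integrable_def)
    qed
    finally show "(LINT t|lborel. indicator {..x} t * v' t) = (LINT t:{0..x}|lebesgue. v t)"
      by (simp add: set_lebesgue_integral_def)
  next
    have "(LINT t|lborel. v' t) = (LINT t|lebesgue. v' t)"
      by (rule integral_completion[symmetric]) simp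
    also have "\<dots> = (LINT t|lebesgue. indicator {0..R} t * v t)"
      by (rule integral_cong_AE) (use ae' int v'm in auto)
    finally show "(LINT t|lborel. v' t) = (LINT t:{0..R}|lebesgue. v t)"
      by (simp add: set_lebesgue_integral_def)
  qed
qed

text \<open>The indefinite integrals of \<open>v\<close> and \<open>w\<close> are
  \<open>f - f 0\<close> and \<open>k - k 0\<close>, so \<open>Fubini_triangles\<close> expresses
  \<open>(f R - f 0) * (k R - k 0)\<close> as the sum of the integrals of
  \<open>v * (k - k 0)\<close> and \<open>w * (f - f 0)\<close>. Expanding the constants gives the
  product rule.\<close>

lemma ac_deriv_mult:
  assumes f: "ac_deriv f v" and k: "ac_deriv k w"
  shows "ac_deriv (\<lambda>x. f x * k x) (\<lambda>x. v x * k x + f x * w x)"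
  unfolding ac_deriv_def
proof (intro allI impI)
  fix R :: real assume R: "R \<ge> 0"
  note iv = ac_derivD(1)[OF f R] and iw = ac_derivD(1)[OF k R]
  \<comment> \<open>The factor \<open>q\<close> is continuous, hence bounded and measurable on
    \<open>{0..R}\<close>, and multiplication by it preserves integrability.\<close>
  have si: "set_integrable lebesgue {0..R} (\<lambda>x. p x * q x)"
    if "set_integrable lebesgue {0..R} p" "ac_deriv q r" for p q r
  proof -
    have "(\<lambda>x. q x * p x) absolutely_integrable_on {0..R}"
    proof (rule absolutely_integrable_bounded_measurable_product_real)
      show "q \<in> borel_measurable (lebesgue_on {0..R})"
        by (rule continuous_imp_measurable_on_sets_lebesgue)
           (use ac_deriv_continuous_on[OF that(2)] in auto)
      show "bounded (q ` {0..R})"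
        using ac_deriv_continuous_on[OF that(2)] compact_continuous_image compact_imp_bounded
        by blast
    qed (use that in auto)
    then show ?thesis by (simp add: mult.commute)
  qed
  obtain v' where v': "integrable lborel v'" "AE t in lebesgue. v' t = indicator {0..R} t * v t"
    "\<And>x. 0 \<le> x \<Longrightarrow> x \<le> R \<Longrightarrow> (LINT t|lborel. indicator {..x} t * v' t) = (LINT t:{0..x}|lebesgue. v t)"
    "(LINT t|lborel. v' t) = (LINT t:{0..R}|lebesgue. v t)"
    by (rule lborel_representative[OF iv]) blast
  obtain w' where w': "integrable lborel w'" "AE t in lebesgue. w' t = indicator {0..R} t * w t"
    "\<And>x. 0 \<le> x \<Longrightarrow> x \<le> R \<Longrightarrow> (LINT t|lborel. indicator {..x} t * w' t) = (LINT t:{0..x}|lebesgue. w t)"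
    "(LINT t|lborel. w' t) = (LINT t:{0..R}|lebesgue. w t)"
    by (rule lborel_representative[OF iw]) blast
  define V where "V = (\<lambda>t. LINT s|lborel. indicator {..t} s * v' s)"
  define W where "W = (\<lambda>t. LINT s|lborel. indicator {..t} s * w' s)"
  have fub: "integrable lborel (\<lambda>t. v' t * W t)" "integrable lborel (\<lambda>t. w' t * V t)"
    "(LINT t|lborel. v' t * W t) + (LINT t|lborel. w' t * V t)
       = (LINT t|lborel. v' t) * (LINT t|lborel. w' t)"
    unfolding V_def W_def by (rule Fubini_triangles[OF v'(1) w'(1)])+
  \<comment> \<open>The identities for \<open>V\<close> and \<open>W\<close> are available on
    \<open>{0..R}\<close> only. This suffices, since \<open>V\<close> and \<open>W\<close> occur
    multiplied by \<open>w'\<close> and \<open>v'\<close>, which vanish almost everywhere outside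
    \<open>{0..R}\<close>.\<close>
  have V: "V x = f x - f 0" if "0 \<le> x" "x \<le> R" for x
    unfolding V_def v'(3)[OF that] by (subst ac_derivD(2)[OF f that(1)]) simp
  have W: "W x = k x - k 0" if "0 \<le> x" "x \<le> R" for x
    unfolding W_def w'(3)[OF that] by (subst ac_derivD(2)[OF k that(1)]) simp
  have ivk: "set_integrable lebesgue {0..R} (\<lambda>x. v x * k x)"
    and iwf: "set_integrable lebesgue {0..R} (\<lambda>x. f x * w x)"
    using si[OF iv k] si[OF iw f] by (simp_all add: mult.commute)
  have 1: "(LINT t|lborel. v' t * W t) = (LINT t:{0..R}|lebesgue. v t * k t - k 0 * v t)"
  proof -
    have "(LINT t|lborel. v' t * W t) = (LINT t|lebesgue. v' t * W t)"
      using fub(1) by (simp add: integral_completion borel_measurable_integrable)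
    also have "\<dots> = (LINT t|lebesgue. indicator {0..R} t * (v t * k t - k 0 * v t))"
    proof (rule integral_cong_AE)
      show "AE t in lebesgue. v' t * W t = indicator {0..R} t * (v t * k t - k 0 * v t)"
        using v'(2) by eventually_elim (auto simp: indicator_def W algebra_simps)
      show "(\<lambda>t. v' t * W t) \<in> borel_measurable lebesgue"
        using fub(1) measurable_completion by blast
      have "set_integrable lebesgue {0..R} (\<lambda>t. v t * k t - k 0 * v t)"
        by (intro set_integral_diff set_integrable_mult_right ivk iv)
      then show "(\<lambda>t. indicator {0..R} t * (v t * k t - k 0 * v t)) \<in> borel_measurable lebesgue"
        by (simp add: set_integrable_def)
    qed
    finally show ?thesis by (simp add: set_lebesgue_integral_def)
  qed
  have 2: "(LINT t|lborel. w' t * V t) = (LINT t:{0..R}|lebesgue. f t * w t - f 0 * w t)"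
  proof -
    have "(LINT t|lborel. w' t * V t) = (LINT t|lebesgue. w' t * V t)"
      using fub(2) by (simp add: integral_completion borel_measurable_integrable)
    also have "\<dots> = (LINT t|lebesgue. indicator {0..R} t * (f t * w t - f 0 * w t))"
    proof (rule integral_cong_AE)
      show "AE t in lebesgue. w' t * V t = indicator {0..R} t * (f t * w t - f 0 * w t)"
        using w'(2) by eventually_elim (auto simp: indicator_def V algebra_simps)
      show "(\<lambda>t. w' t * V t) \<in> borel_measurable lebesgue"
        using fub(2) measurable_completion by blast
      have "set_integrable lebesgue {0..R} (\<lambda>t. f t * w t - f 0 * w t)"
        by (intro set_integral_diff set_integrable_mult_right iwf iw)
      then show "(\<lambda>t. indicator {0..R} t * (f t * w t - f 0 * w t)) \<in> borel_measurable lebesgue"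
        by (simp add: set_integrable_def)
    qed
    finally show ?thesis by (simp add: set_lebesgue_integral_def)
  qed
  have v4: "(LINT t|lborel. v' t) = f R - f 0" and w4: "(LINT t|lborel. w' t) = k R - k 0"
    using v'(4) w'(4) ac_derivD(2)[OF f R] ac_derivD(2)[OF k R] by linarith+
  have 1: "(LINT t|lborel. v' t * W t) = (LINT t:{0..R}|lebesgue. v t * k t) - k 0 * (f R - f 0)"
    unfolding 1 v4[unfolded v'(4), symmetric] using ivk iv by simp
  have 2: "(LINT t|lborel. w' t * V t) = (LINT t:{0..R}|lebesgue. f t * w t) - f 0 * (k R - k 0)"
    unfolding 2 w4[unfolded w'(4), symmetric] using iwf iw by simp
  note fub(3)[unfolded 1 2 v4 w4]
  then have "f R * k R = f 0 * k 0 + ((LINT t:{0..R}|lebesgue. v t * k t) + (LINT t:{0..R}|lebesgue. f t * w t))"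
    by algebra
  then show "set_integrable lebesgue {0..R} (\<lambda>x. v x * k x + f x * w x) \<and>
      f R * k R = f 0 * k 0 + (LINT t:{0..R}|lebesgue. v t * k t + f t * w t)"
    using ivk iwf by simp
qed

lemma ac_derivI_C1:
  assumes "\<And>x. x \<ge> 0 \<Longrightarrow> (f has_real_derivative w x) (at x within {0..})" "continuous_on {0..} w"
  shows "ac_deriv f w"
  unfolding ac_deriv_def
proof (intro allI impI)
  fix R :: real assume R: "R \<ge> 0"
  have c: "continuous_on {0..R} w" by (rule continuous_on_subset[OF assms(2)]) auto
  then have i: "set_integrable lebesgue {0..R} w" by (rule absolutely_integrable_continuous_real)
  have "(w has_integral f R - f 0) {0..R}"
  proof (rule fundamental_theorem_of_calculus[OF R])
    fix x assume "x \<in> {0..R}"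
    then have "(f has_real_derivative w x) (at x within {0..R})"
      by (intro DERIV_subset[OF assms(1)]) auto
    then show "(f has_vector_derivative w x) (at x within {0..R})"
      by (simp add: has_real_derivative_iff_has_vector_derivative)
  qed
  then show "set_integrable lebesgue {0..R} w \<and> f R = f 0 + (LINT t:{0..R}|lebesgue. w t)"
    using i set_lebesgue_integral_eq_integral(2)[OF i] by (simp add: integral_unique)
qed

section \<open>The fundamental lemma of the calculus of variations\<close>

lemma test_functionI:
  assumes "\<And>x. (\<phi> has_real_derivative D x) (at x)" "continuous_on UNIV D"
    and "0 < a" "\<And>x. x \<notin> {a..b} \<Longrightarrow> \<phi> x = 0"
  shows "\<phi> \<in> test_functions"
  unfolding test_functions_def mem_Collect_eq C1_differentiable_on_def
proof (intro conjI exI)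
  show "\<forall>x\<in>UNIV. (\<phi> has_vector_derivative D x) (at x)"
    using assms(1) by (simp add: has_real_derivative_iff_has_vector_derivative)
  show "{a..b} \<subseteq> {0<..}" using \<open>0 < a\<close> by auto
  show "\<forall>x. x \<notin> {a..b} \<longrightarrow> \<phi> x = 0" using assms(4) by blast
qed (use assms in auto)

lemma test_functionE:
  assumes "\<phi> \<in> test_functions"
  obtains a b where "0 < a" "a < b" "\<And>x. x \<notin> {a..b} \<Longrightarrow> \<phi> x = 0"
    "\<And>x. x \<notin> {a..b} \<Longrightarrow> deriv \<phi> x = 0"
    "\<And>x. (\<phi> has_real_derivative deriv \<phi> x) (at x)" "continuous_on UNIV (deriv \<phi>)"
proof -
  from assms obtain D where D: "\<And>x. (\<phi> has_real_derivative D x) (at x)" "continuous_on UNIV D"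
    by (auto simp: test_functions_def C1_differentiable_on_def has_real_derivative_iff_has_vector_derivative)
  have eq: "deriv \<phi> = D" using D(1) DERIV_imp_deriv by blast
  from assms obtain K where K: "compact K" "K \<subseteq> {0<..}" "\<And>x. x \<notin> K \<Longrightarrow> \<phi> x = 0"
    by (auto simp: test_functions_def)
  have "\<exists>a b. 0 < a \<and> a < b \<and> K \<subseteq> {a..b}"
  proof (cases "K = {}")
    case True
    then show ?thesis by (intro exI[of _ 1] exI[of _ 2]) auto
  next
    case False
    from compact_attains_inf[OF K(1) False] compact_attains_sup[OF K(1) False]
    obtain s t where st: "s \<in> K" "\<And>x. x \<in> K \<Longrightarrow> s \<le> x" "t \<in> K" "\<And>x. x \<in> K \<Longrightarrow> x \<le> t" by blast
    then have "0 < s" "s \<le> t" using K(2) by auto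
    \<comment> \<open>The \<open>+ 1\<close> keeps the interval nondegenerate when \<open>K\<close>
      is a single point.\<close>
    then show ?thesis using st by (intro exI[of _ s] exI[of _ "t + 1"]) force
  qed
  then obtain a b where ab: "0 < a" "a < b" "K \<subseteq> {a..b}" by blast
  show thesis
  proof
    show "0 < a" "a < b" by fact+
    show z: "\<phi> x = 0" if "x \<notin> {a..b}" for x using that ab(3) K(3) by blast
    show "deriv \<phi> x = 0" if "x \<notin> {a..b}" for x
    proof -
      have "open (- {a..b})" by (simp add: open_Compl)
      then have "(\<phi> has_real_derivative 0) (at x)"
        using that z by (intro DERIV_cong_ev[THEN iffD2, OF refl _ refl DERIV_const[of 0]])
          (auto simp: eventually_nhds intro!: exI[of _ "- {a..b}"])
      then show ?thesis by (rule DERIV_imp_deriv)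
    qed
  qed (use D eq in auto)
qed

section \<open>C^1 approximation of the indicator of an interval\<close>

lemma has_derivative_max0_square:
  "((\<lambda>y::real. (max 0 y)\<^sup>2) has_real_derivative 2 * max 0 y) (at y)"
proof -
  consider "y < 0" | "y = 0" | "y > 0" by linarith
  then show ?thesis
  proof cases
    case 1
    have "((\<lambda>y::real. 0) has_real_derivative 2 * max 0 y) (at y)" using 1 by simp
    then show ?thesis
      by (rule has_field_derivative_transform_within_open[where S="{..<0}"]) (use 1 in auto)
  next
    case 2
    have "((\<lambda>h::real. max 0 h) \<longlongrightarrow> max 0 0) (at 0)" by (intro tendsto_intros)
    then have "((\<lambda>h::real. max 0 h) \<longlongrightarrow> 0) (at 0)" by simp
    then have "((\<lambda>h::real. (max 0 h)\<^sup>2 / h) \<longlongrightarrow> 0) (at 0)"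
      by (rule Lim_transform_eventually)
         (auto simp: eventually_at_filter max_def power2_eq_square)
    then show ?thesis using 2 by (simp add: DERIV_def)
  next
    case 3
    have "((\<lambda>y::real. y\<^sup>2) has_real_derivative 2 * max 0 y) (at y)"
      using 3 by (auto intro!: derivative_eq_intros)
    then show ?thesis
      by (rule has_field_derivative_transform_within_open[where S="{0<..}"]) (use 3 in auto)
  qed
qed

text \<open>The map \<open>q \<mapsto> n q / (1 + n q)\<close> saturates at 1 as \<open>n\<close>
  grows, so for \<open>a < b\<close> the bumps have values between 0 and 1, vanish off
  \<open>{a<..<b}\<close> and tend to 1 on it. Squaring the positive part makes the gluing at
  \<open>a\<close> and \<open>b\<close> continuously differentiable.\<close>

definition bump :: "real \<Rightarrow> real \<Rightarrow> nat \<Rightarrow> real \<Rightarrow> real" where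
  "bump a b n x = n * (max 0 ((x - a) * (b - x)))\<^sup>2 / (1 + n * (max 0 ((x - a) * (b - x)))\<^sup>2)"

lemma one_plus_square_pos: "0 < 1 + real n * (max 0 y)\<^sup>2"
  by (meson add_pos_nonneg mult_nonneg_nonneg of_nat_0_le_iff zero_le_power2 zero_less_one)

lemma bump_eq_0: "a < b \<Longrightarrow> x \<notin> {a<..<b} \<Longrightarrow> bump a b n x = 0"
proof -
  assume "a < b" "x \<notin> {a<..<b}"
  then have "(x - a) * (b - x) \<le> 0" by (auto simp: mult_le_0_iff not_less)
  then show ?thesis by (simp add: bump_def max_def)
qed

lemma bump_le_1: "\<bar>bump a b n x\<bar> \<le> 1"
  using one_plus_square_pos[of n "(x - a) * (b - x)"] by (simp add: bump_def abs_mult)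

lemma bump_limit: "a < x \<Longrightarrow> x < b \<Longrightarrow> (\<lambda>n. bump a b n x) \<longlonglongrightarrow> 1"
proof -
  assume "a < x" "x < b"
  define q where "q = (max 0 ((x - a) * (b - x)))\<^sup>2"
  have "q > 0" using \<open>a < x\<close> \<open>x < b\<close> by (simp add: q_def max_def)
  have "(\<lambda>n::nat. 1 - 1 / (1 + real n * q)) \<longlonglongrightarrow> 1 - 0"
    using \<open>q > 0\<close>
    by (intro tendsto_diff tendsto_const tendsto_divide_0[OF tendsto_const]
      filterlim_at_top_imp_at_infinity filterlim_tendsto_add_at_top[OF tendsto_const]
      filterlim_at_top_mult_tendsto_pos[OF tendsto_const] filterlim_real_sequentially)
  moreover have "1 - 1 / (1 + real n * q) = bump a b n x" for n
    using one_plus_square_pos[of n "(x - a) * (b - x)", folded q_def]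
    unfolding bump_def q_def[symmetric] by (simp add: field_simps)
  ultimately show ?thesis by simp
qed

lemma bump_test:
  assumes "0 < a" "a < b"
  shows "bump a b n \<in> test_functions"
proof (rule test_functionI)
  define Q where "Q = (\<lambda>x. (max 0 ((x - a) * (b - x)))\<^sup>2)"
  define Q' where "Q' = (\<lambda>x. 2 * max 0 ((x - a) * (b - x)) * (a + b - 2 * x))"
  have Q: "(Q has_real_derivative Q' x) (at x)" for x
    unfolding Q_def Q'_def
    by (rule DERIV_chain2[OF has_derivative_max0_square]) (auto intro!: derivative_eq_intros)
  have pos: "1 + real n * Q x > 0" for x unfolding Q_def by (rule one_plus_square_pos)
  then have nz: "1 + real n * Q x \<noteq> 0" for x by (metis less_irrefl)
  show "(bump a b n has_real_derivative n * Q' x / (1 + n * Q x)\<^sup>2) (at x)" for x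
  proof -
    have "((\<lambda>x. n * Q x / (1 + n * Q x)) has_real_derivative n * Q' x / (1 + n * Q x)\<^sup>2) (at x)"
      using nz[of x] by (auto intro!: derivative_eq_intros Q simp: power2_eq_square field_simps)
    then show ?thesis by (simp add: bump_def[abs_def] Q_def)
  qed
  have "continuous_on UNIV Q" unfolding Q_def by (intro continuous_intros)
  moreover have "continuous_on UNIV Q'" unfolding Q'_def by (intro continuous_intros)
  ultimately show "continuous_on UNIV (\<lambda>x. n * Q' x / (1 + n * Q x)\<^sup>2)"
    using nz by (intro continuous_intros) auto
  show "bump a b n x = 0" if "x \<notin> {a..b}" for x
    by (rule bump_eq_0) (use assms that in auto)
qed (use assms in auto)

text \<open>The point 0 is a null set. Energies and test functions refer to the open half-line,
  continuous representatives to the closed one.\<close>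

lemma halfline_closed_open:
  "set_integrable lebesgue {0<..R} f \<longleftrightarrow> set_integrable lebesgue {0..(R::real)} f"
  "set_integrable lebesgue {0<..} f \<longleftrightarrow> set_integrable lebesgue {0::real..} f"
  "(LINT x:{0<..R}|lebesgue. f x) = (LINT x:{0..R}|lebesgue. f x)"
  "(LINT x:{0<..}|lebesgue. f x) = (LINT x:{0..}|lebesgue. f x)"
  for f :: "real \<Rightarrow> real"
  by (intro set_integrable_discrete_difference[where X="{0}"]
     set_integral_discrete_difference[where X="{0}"]; force)+

text \<open>Testing against the bumps and passing to the limit by dominated convergence shows that
  the integral of \<open>f\<close> over every interval \<open>{a<..<b}\<close> with
  \<open>0 < a < b\<close> is 0. Lebesgue's differentiation theorem then gives
  \<open>f x = 0\<close> at almost every \<open>x > 0\<close>.\<close>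

lemma fundamental_lemma_test_functions:
  fixes f :: "real \<Rightarrow> real"
  assumes f: "\<And>R. set_integrable lebesgue {0..R} f"
    and 0: "\<And>\<phi>. \<phi> \<in> test_functions \<Longrightarrow> (LINT x:{0<..}|lebesgue. f x * \<phi> x) = 0"
  shows "AE x in lebesgue. x > 0 \<longrightarrow> f x = 0"
proof -
  have I0: "(LINT x:{a<..<b}|lebesgue. f x) = 0" if ab: "0 < a" "a < b" for a b
  proof -
    have int: "integrable lebesgue (\<lambda>x. indicator {a<..<b} x * f x)"
      using set_integrable_subset[OF f[of b], of "{a<..<b}"] ab by (force simp: set_integrable_def)
    have "(\<lambda>n. LINT x|lebesgue. indicator {a<..<b} x * f x * bump a b n x)
        \<longlonglongrightarrow> (LINT x|lebesgue. indicator {a<..<b} x * f x)"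
    proof (rule integral_dominated_convergence)
      show "integrable lebesgue (\<lambda>x. \<bar>indicator {a<..<b} x * f x\<bar>)" using int by (rule integrable_abs)
      show "(\<lambda>x. indicator {a<..<b} x * f x) \<in> borel_measurable lebesgue" using int by auto
      have "bump a b n \<in> borel_measurable lborel" for n unfolding bump_def[abs_def] by measurable
      then have "bump a b n \<in> borel_measurable lebesgue" for n by (rule measurable_completion)
      then show "(\<lambda>x. indicator {a<..<b} x * f x * bump a b n x) \<in> borel_measurable lebesgue" for n
        using borel_measurable_times[OF borel_measurable_integrable[OF int]] by blast
      show "AE x in lebesgue. (\<lambda>n. indicator {a<..<b} x * f x * bump a b n x)
              \<longlonglongrightarrow> indicator {a<..<b} x * f x"
      proof (rule AE_I2)
        fix x
        show "(\<lambda>n. indicator {a<..<b} x * f x * bump a b n x) \<longlonglongrightarrow> indicator {a<..<b} x * f x"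
          using tendsto_mult[OF tendsto_const[of "f x"] bump_limit[of a x b]]
          by (cases "x \<in> {a<..<b}") auto
      qed
      show "AE x in lebesgue. norm (indicator {a<..<b} x * f x * bump a b n x)
              \<le> \<bar>indicator {a<..<b} x * f x\<bar>" for n
        using bump_le_1 by (intro AE_I2) (simp add: abs_mult mult_left_le)
    qed
    moreover have "(LINT x|lebesgue. indicator {a<..<b} x * f x * bump a b n x) = 0" for n
    proof -
      have "(LINT x|lebesgue. indicator {a<..<b} x * f x * bump a b n x)
          = (LINT x:{0<..}|lebesgue. f x * bump a b n x)"
        unfolding set_lebesgue_integral_def
        by (rule Bochner_Integration.integral_cong)
           (use ab bump_eq_0[of a b] in \<open>auto simp: indicator_def\<close>)
      then show ?thesis using 0 bump_test[OF ab] by simp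
    qed
    ultimately show ?thesis
      by (simp add: set_lebesgue_integral_def LIMSEQ_const_iff)
  qed
  \<comment> \<open>The differentiation theorem is applied on the whole line, so \<open>f\<close> is
    first extended by 0 to a function integrable on every compact interval.\<close>
  define F where "F = (\<lambda>x. if x > 0 then f x else 0)"
  have Fint: "set_integrable lebesgue {a..b} F" for a b
  proof -
    have "set_integrable lebesgue {0<..b} f" using f halfline_closed_open(1) by blast
    then have "set_integrable lebesgue {-\<bar>a\<bar>..b} F"
      unfolding set_integrable_def
      by (rule Bochner_Integration.integrable_cong[THEN iffD1, rotated 2])
         (auto simp: F_def indicator_def)
    then show ?thesis by (rule set_integrable_subset) auto
  qed
  then have Fcb: "F integrable_on cbox a b" for a b
    using set_lebesgue_integral_eq_integral(1)[of "{a..b}" F] by simp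
  from integrable_ccontinuous_explicit[OF Fcb] obtain N where N: "negligible N"
    "\<And>x e. x \<notin> N \<Longrightarrow> 0 < e \<Longrightarrow> \<exists>d>0. \<forall>h. 0 < h \<and> h < d \<longrightarrow>
       norm (integral (cbox x (x + h *\<^sub>R One)) F /\<^sub>R h ^ DIM(real) - F x) < e" by blast
  have Fz: "f x = 0" if "x \<notin> N" "x > 0" for x
  proof (rule ccontr)
    assume "f x \<noteq> 0"
    with N(2)[OF that(1), of "\<bar>f x\<bar>"] obtain d where d: "d > 0"
      "\<And>h. 0 < h \<Longrightarrow> h < d \<Longrightarrow> norm (integral (cbox x (x + h *\<^sub>R One)) F /\<^sub>R h ^ DIM(real) - F x) < \<bar>f x\<bar>"
      by auto
    \<comment> \<open>The mean of \<open>F\<close> over \<open>{x..x+d/2}\<close> is 0, so its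
      distance to \<open>F x\<close> equals \<open>\<bar>f x\<bar>\<close>, against the strict bound
      for \<open>h = d/2\<close>.\<close>
    have "integral {x..x + d/2} F = (LINT y:{x..x+d/2}|lebesgue. F y)"
      using set_lebesgue_integral_eq_integral(2)[OF Fint] by simp
    also have "\<dots> = (LINT y:{x<..<x+d/2}|lebesgue. F y)"
      by (rule set_integral_discrete_difference[where X="{x, x+d/2}"]) auto
    also have "\<dots> = (LINT y:{x<..<x+d/2}|lebesgue. f y)"
      by (rule set_lebesgue_integral_cong) (use that in \<open>auto simp: F_def\<close>)
    also have "\<dots> = 0" using I0 that d(1) by simp
    finally show False using d(2)[of "d/2"] d(1) that by (simp add: F_def)
  qed
  have "N \<in> null_sets lebesgue" using N(1) by (simp add: negligible_iff_null_sets)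
  from AE_not_in[OF this] show ?thesis by eventually_elim (use Fz in auto)
qed

text \<open>Otherwise the constant 1 would annihilate all test functions, and the fundamental lemma
  would give \<open>1 = 0\<close> almost everywhere on the half-line.\<close>

lemma exists_test_function_integral_nonzero:
  obtains \<psi> where "\<psi> \<in> test_functions" "(LINT x:{0<..}|lebesgue. \<psi> x) \<noteq> 0"
proof (rule ccontr)
  assume *: "\<not> thesis"
  have "AE x in lebesgue. x > (0::real) \<longrightarrow> (1::real) = 0"
  proof (rule fundamental_lemma_test_functions)
    show "set_integrable lebesgue {0..R} (\<lambda>x. 1::real)" for R :: real
      by (intro absolutely_integrable_continuous_real continuous_intros)
    show "(LINT x:{0<..}|lebesgue. 1 * \<phi> x) = 0" if "\<phi> \<in> test_functions" for \<phi>
      using * that[THEN \<open>\<And>\<psi>. \<psi> \<in> test_functions \<Longrightarrow> (LINT x:{0<..}|lebesgue. \<psi> x) \<noteq> 0 \<Longrightarrow> thesis\<close>] by auto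
  qed
  then have "AE x in lebesgue. x \<notin> {0<..<1::real}" by eventually_elim auto
  then have "{0<..<1::real} \<in> null_sets lebesgue"
    by (subst AE_iff_null_sets) auto
  then show False by (simp add: null_sets_def)
qed

section \<open>Continuous representatives and weak derivatives\<close>

lemma local_integrable_times_compact_support:
  fixes f k :: "real \<Rightarrow> real"
  assumes f: "\<And>R. set_integrable lebesgue {0..R} f" and k: "continuous_on UNIV k"
    and supp: "\<And>x. x \<notin> {a..b} \<Longrightarrow> k x = 0"
  shows "set_integrable lebesgue {0<..} (\<lambda>x. f x * k x)"
    and "(LINT x:{0<..}|lebesgue. f x * k x) = (LINT x:{0..b}|lebesgue. f x * k x)"
proof -
  have "(\<lambda>x. k x * f x) absolutely_integrable_on {0..b}"
  proof (rule absolutely_integrable_bounded_measurable_product_real)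
    have c: "continuous_on {0..b} k" using k by (rule continuous_on_subset) auto
    then show "k \<in> borel_measurable (lebesgue_on {0..b})"
      by (rule continuous_imp_measurable_on_sets_lebesgue) auto
    show "bounded (k ` {0..b})"
      using c compact_continuous_image compact_imp_bounded by blast
  qed (use f in auto)
  then have *: "set_integrable lebesgue {0<..b} (\<lambda>x. f x * k x)"
    by (simp add: halfline_closed_open mult.commute)
  have eq: "indicator {0<..b} x *\<^sub>R (f x * k x) = indicator {0<..} x *\<^sub>R (f x * k x)" for x :: real
    using supp[of x] by (auto simp: indicator_def)
  show "set_integrable lebesgue {0<..} (\<lambda>x. f x * k x)"
    using * unfolding set_integrable_def eq .
  have "(LINT x:{0<..}|lebesgue. f x * k x) = (LINT x:{0<..b}|lebesgue. f x * k x)"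
    unfolding set_lebesgue_integral_def eq ..
  then show "(LINT x:{0<..}|lebesgue. f x * k x) = (LINT x:{0..b}|lebesgue. f x * k x)"
    by (simp add: halfline_closed_open)
qed

lemma test_function_integrable:
  assumes "\<And>R. set_integrable lebesgue {0..R} f" "\<phi> \<in> test_functions"
  shows "set_integrable lebesgue {0<..} (\<lambda>x. f x * \<phi> x)"
    "set_integrable lebesgue {0<..} (\<lambda>x. f x * deriv \<phi> x)"
proof -
  obtain a b where ab: "0 < a" "a < b" "\<And>x. x \<notin> {a..b} \<Longrightarrow> \<phi> x = 0"
    "\<And>x. x \<notin> {a..b} \<Longrightarrow> deriv \<phi> x = 0"
    "\<And>x. (\<phi> has_real_derivative deriv \<phi> x) (at x)" "continuous_on UNIV (deriv \<phi>)"
    by (rule test_functionE[OF assms(2)]) blast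
  have "continuous_on UNIV \<phi>" using ab(5) DERIV_isCont continuous_at_imp_continuous_on by blast
  then show "set_integrable lebesgue {0<..} (\<lambda>x. f x * \<phi> x)"
    "set_integrable lebesgue {0<..} (\<lambda>x. f x * deriv \<phi> x)"
    using local_integrable_times_compact_support(1)[OF assms(1)] ab by blast+
qed

lemma ac_deriv_integrable:
  assumes "ac_deriv G v"
  shows "set_integrable lebesgue {0..R} v" "set_integrable lebesgue {0..R} G"
proof -
  show "set_integrable lebesgue {0..R} v"
    using ac_derivD(1)[OF assms, of R] by (cases "R \<ge> 0") auto
  show "set_integrable lebesgue {0..R} G"
    by (intro absolutely_integrable_continuous_real ac_deriv_continuous_on[OF assms])
qed

text \<open>The product rule for \<open>G * \<phi>\<close> is integrated up to \<open>b + 1\<close>,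
  beyond the support of \<open>\<phi>\<close>. Both boundary terms vanish, because the support also
  stays away from 0.\<close>

lemma ac_deriv_imp_weak_derivative:
  assumes "ac_deriv G v"
  shows "has_weak_derivative G v"
  unfolding has_weak_derivative_def
proof
  fix \<phi> assume \<phi>: "\<phi> \<in> test_functions"
  obtain a b where ab: "0 < a" "a < b" "\<And>x. x \<notin> {a..b} \<Longrightarrow> \<phi> x = 0"
    "\<And>x. x \<notin> {a..b} \<Longrightarrow> deriv \<phi> x = 0"
    "\<And>x. (\<phi> has_real_derivative deriv \<phi> x) (at x)" "continuous_on UNIV (deriv \<phi>)"
    by (rule test_functionE[OF \<phi>]) blast
  have c: "continuous_on UNIV \<phi>" using ab(5) DERIV_isCont continuous_at_imp_continuous_on by blast
  have "ac_deriv \<phi> (deriv \<phi>)"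
    by (rule ac_derivI_C1)
       (use ab(5,6) DERIV_subset continuous_on_subset in \<open>blast+\<close>)
  from ac_deriv_mult[OF assms this]
  have ac: "ac_deriv (\<lambda>x. G x * \<phi> x) (\<lambda>x. v x * \<phi> x + G x * deriv \<phi> x)" .
  define R where "R = b + 1"
  have R: "R \<ge> 0" "R \<notin> {a..b}" "0 \<notin> {a..b}" using ab by (auto simp: R_def)
  have "(LINT x:{0..R}|lebesgue. v x * \<phi> x + G x * deriv \<phi> x) = 0"
    using ac_derivD(2)[OF ac R(1)] ab(3)[OF R(2)] ab(3)[OF R(3)] by simp
  moreover have "\<And>x. x \<notin> {a..R} \<Longrightarrow> \<phi> x = 0" "\<And>x. x \<notin> {a..R} \<Longrightarrow> deriv \<phi> x = 0"
    using ab(3,4) by (auto simp: R_def)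
  then have "(LINT x:{0<..}|lebesgue. v x * \<phi> x) = (LINT x:{0..R}|lebesgue. v x * \<phi> x)"
    "(LINT x:{0<..}|lebesgue. G x * deriv \<phi> x) = (LINT x:{0..R}|lebesgue. G x * deriv \<phi> x)"
    using local_integrable_times_compact_support(2)[OF ac_deriv_integrable(1)[OF assms] c]
      local_integrable_times_compact_support(2)[OF ac_deriv_integrable(2)[OF assms] ab(6)] by blast+
  moreover have "set_integrable lebesgue {0..R} (\<lambda>x. v x * \<phi> x)"
      "set_integrable lebesgue {0..R} (\<lambda>x. G x * deriv \<phi> x)"
    using test_function_integrable[OF ac_deriv_integrable(1)[OF assms] \<phi>]
      test_function_integrable[OF ac_deriv_integrable(2)[OF assms] \<phi>]
    by (auto simp: halfline_closed_open intro: set_integrable_subset)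
  ultimately show "(LINT x:{0<..}|lebesgue. G x * deriv \<phi> x) = - (LINT x:{0<..}|lebesgue. v x * \<phi> x)"
    by simp
qed

text \<open>The primitive from 0 vanishes to the left of the support of \<open>w\<close>; to the
  right of it, the primitive equals the total integral, which is 0 by assumption. Hence the
  primitive has compact support again.\<close>

lemma test_function_antiderivative:
  assumes w: "w \<in> test_functions" and w0: "(LINT x:{0<..}|lebesgue. w x) = 0"
  obtains \<phi> where "\<phi> \<in> test_functions" "deriv \<phi> = w"
proof -
  obtain a b where ab: "0 < a" "a < b" "\<And>x. x \<notin> {a..b} \<Longrightarrow> w x = 0"
    "\<And>x. (w has_real_derivative deriv w x) (at x)"
    by (rule test_functionE[OF w]) blast
  have c: "continuous_on UNIV w" using ab(4) DERIV_isCont continuous_at_imp_continuous_on by blast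
  then have cI: "continuous_on {s..t} w" for s t by (rule continuous_on_subset) auto
  define \<phi> where "\<phi> = (\<lambda>x. integral {0..x} w)"
  have low: "\<phi> x = 0" if "x < a" for x
  proof -
    have "\<phi> x = integral {0..x} (\<lambda>_. 0)" unfolding \<phi>_def
      by (rule Henstock_Kurzweil_Integration.integral_cong) (use that ab(3) in auto)
    then show ?thesis by simp
  qed
  have high: "\<phi> x = 0" if "x > b" for x
  proof -
    have 1: "set_integrable lebesgue {0..x} w"
      by (rule absolutely_integrable_continuous_real[OF cI])
    have "\<phi> x = (LINT y:{0..x}|lebesgue. w y)"
      unfolding \<phi>_def using set_lebesgue_integral_eq_integral(2)[OF 1] by simp
    also have "\<dots> = (LINT y:{0<..}|lebesgue. w y)"
    proof -
      have "w y = 0" if "y \<notin> {a..x}" for y using ab(3)[of y] that \<open>x > b\<close> by auto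
      from local_integrable_times_compact_support(2)[of "\<lambda>_. 1", OF _ c this] show ?thesis
        by (simp add: absolutely_integrable_continuous_real)
    qed
    finally show ?thesis using w0 by simp
  qed
  have d: "(\<phi> has_real_derivative w x) (at x)" for x
  proof (cases "x < a")
    case True
    have "((\<lambda>_. 0) has_real_derivative 0) (at x)" by simp
    then have "(\<phi> has_real_derivative 0) (at x)"
      by (rule has_field_derivative_transform_within_open[where S="{..<a}"]) (use True low in auto)
    then show ?thesis using ab(3) True by simp
  next
    case False
    then have "x > 0" using ab by simp
    have "(\<phi> has_real_derivative w x) (at x within {0..x+1})"
      unfolding \<phi>_def by (rule integral_has_real_derivative) (use cI \<open>x > 0\<close> in auto)
    then show ?thesis using \<open>x > 0\<close> at_within_Icc_at[of 0 x "x+1"] by simp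
  qed
  show thesis
  proof
    show "\<phi> \<in> test_functions"
      by (rule test_functionI[OF d c ab(1)]) (use low high in \<open>auto simp: not_le\<close>)
    show "deriv \<phi> = w" using d DERIV_imp_deriv by blast
  qed
qed

lemma test_functions_lincomb:
  assumes "w \<in> test_functions" "\<psi> \<in> test_functions"
  shows "(\<lambda>x. w x - c * \<psi> x) \<in> test_functions"
proof -
  obtain a b where ab: "0 < a" "a < b" "\<And>x. x \<notin> {a..b} \<Longrightarrow> w x = 0"
    "\<And>x. (w has_real_derivative deriv w x) (at x)" "continuous_on UNIV (deriv w)"
    by (rule test_functionE[OF assms(1)]) blast
  obtain a' b' where ab': "0 < a'" "a' < b'" "\<And>x. x \<notin> {a'..b'} \<Longrightarrow> \<psi> x = 0"
    "\<And>x. (\<psi> has_real_derivative deriv \<psi> x) (at x)" "continuous_on UNIV (deriv \<psi>)"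
    by (rule test_functionE[OF assms(2)]) blast
  show ?thesis
  proof (rule test_functionI)
    show "((\<lambda>x. w x - c * \<psi> x) has_real_derivative deriv w x - c * deriv \<psi> x) (at x)" for x
      by (intro DERIV_diff DERIV_cmult ab ab')
    show "continuous_on UNIV (\<lambda>x. deriv w x - c * deriv \<psi> x)"
      by (intro continuous_intros ab ab')
    show "0 < min a a'" using ab ab' by simp
    show "w x - c * \<psi> x = 0" if "x \<notin> {min a a'..max b b'}" for x
      using that ab(3)[of x] ab'(3)[of x] by (auto simp: min_le_iff_disj le_max_iff_disj)
  qed
qed

text \<open>The lemma of du Bois-Reymond: \<open>u - G\<close> annihilates all derivatives of test functions, and
  up to a multiple of one fixed test function every test function is such a derivative.\<close>
lemma has_weak_derivative_imp_ac:
  assumes u: "\<And>R. set_integrable lebesgue {0..R} u" and v: "\<And>R. set_integrable lebesgue {0..R} v"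
    and weak: "has_weak_derivative u v"
  obtains g where "ac_deriv g v" "AE x in lebesgue. x > 0 \<longrightarrow> u x = g x"
proof -
  define G where "G = (\<lambda>x. LINT t:{0..x}|lebesgue. v t)"
  have G0: "G 0 = 0"
  proof -
    have "G 0 = (LINT t:{}|lebesgue. v t)"
      unfolding G_def by (rule set_integral_discrete_difference[where X="{0}"]) auto
    then show ?thesis by (simp add: set_lebesgue_integral_def)
  qed
  have G: "ac_deriv G v" unfolding ac_deriv_def using v G0 by (simp add: G_def)
  define h where "h = (\<lambda>x. u x - G x)"
  have h: "set_integrable lebesgue {0..R} h" for R
    unfolding h_def by (intro set_integral_diff u ac_deriv_integrable(2)[OF G])
  have h0: "(LINT x:{0<..}|lebesgue. h x * deriv \<phi> x) = 0" if \<phi>: "\<phi> \<in> test_functions" for \<phi>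
  proof -
    have "(LINT x:{0<..}|lebesgue. h x * deriv \<phi> x)
      = (LINT x:{0<..}|lebesgue. u x * deriv \<phi> x - G x * deriv \<phi> x)"
      by (simp add: h_def left_diff_distrib)
    also have "\<dots> = (LINT x:{0<..}|lebesgue. u x * deriv \<phi> x) - (LINT x:{0<..}|lebesgue. G x * deriv \<phi> x)"
      by (intro set_integral_diff test_function_integrable[OF _ \<phi>] u ac_deriv_integrable(2)[OF G])
    finally show ?thesis
      using weak ac_deriv_imp_weak_derivative[OF G] \<phi> by (simp add: has_weak_derivative_def)
  qed
  obtain \<psi> where \<psi>: "\<psi> \<in> test_functions" "(LINT x:{0<..}|lebesgue. \<psi> x) \<noteq> 0"
    by (rule exists_test_function_integral_nonzero)
  define J where "J = (LINT x:{0<..}|lebesgue. \<psi> x)"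
  \<comment> \<open>The only possible value of the constant \<open>h\<close>: it makes
    \<open>h - c\<close> annihilate the reference function \<open>\<psi>\<close>.\<close>
  define c where "c = (LINT x:{0<..}|lebesgue. h x * \<psi> x) / J"
  have one: "set_integrable lebesgue {0..R} (\<lambda>x. 1::real)" for R :: real
    by (intro absolutely_integrable_continuous_real continuous_intros)
  have ti: "set_integrable lebesgue {0<..} w" if "w \<in> test_functions" for w
    using test_function_integrable(1)[OF one that] by simp
  have "AE x in lebesgue. x > 0 \<longrightarrow> h x - c = 0"
  proof (rule fundamental_lemma_test_functions)
    show "set_integrable lebesgue {0..R} (\<lambda>x. h x - c)" for R
      using one[of R] by (intro set_integral_diff h absolutely_integrable_continuous_real continuous_intros)
    fix w assume w: "w \<in> test_functions"
    define I where "I = (LINT x:{0<..}|lebesgue. w x)"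
    \<comment> \<open>Subtracting this multiple of \<open>\<psi>\<close> makes the integral vanish,
      so the difference is the derivative of a test function and is annihilated by
      \<open>h\<close>.\<close>
    have t: "(\<lambda>x. w x - I / J * \<psi> x) \<in> test_functions"
      by (rule test_functions_lincomb[OF w \<psi>(1)])
    have "(LINT x:{0<..}|lebesgue. w x - I / J * \<psi> x) = I - I / J * J"
      using ti[OF w] ti[OF \<psi>(1)] by (simp add: set_integral_diff I_def J_def)
    then have "(LINT x:{0<..}|lebesgue. w x - I / J * \<psi> x) = 0" using \<psi>(2) by (simp add: J_def)
    then obtain \<phi> where \<phi>: "\<phi> \<in> test_functions" "deriv \<phi> = (\<lambda>x. w x - I / J * \<psi> x)"
      by (rule test_function_antiderivative[OF t])
    have iw: "set_integrable lebesgue {0<..} (\<lambda>x. h x * w x)"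
      and i\<psi>: "set_integrable lebesgue {0<..} (\<lambda>x. h x * \<psi> x)"
      using test_function_integrable(1)[OF h] w \<psi>(1) by blast+
    have "0 = (LINT x:{0<..}|lebesgue. h x * (w x - I / J * \<psi> x))"
      using h0[OF \<phi>(1)] \<phi>(2) by simp
    also have "\<dots> = (LINT x:{0<..}|lebesgue. h x * w x - I / J * (h x * \<psi> x))"
      by (simp add: algebra_simps)
    also have "\<dots> = (LINT x:{0<..}|lebesgue. h x * w x) - I / J * (LINT x:{0<..}|lebesgue. h x * \<psi> x)"
      using iw i\<psi> by simp
    finally have "(LINT x:{0<..}|lebesgue. h x * w x) = c * I" by (simp add: c_def field_simps)
    moreover have "(LINT x:{0<..}|lebesgue. (h x - c) * w x)
        = (LINT x:{0<..}|lebesgue. h x * w x - c * w x)" by (simp add: algebra_simps)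
    ultimately show "(LINT x:{0<..}|lebesgue. (h x - c) * w x) = 0"
      using iw ti[OF w] by (simp add: I_def)
  qed
  then have ae: "AE x in lebesgue. x > 0 \<longrightarrow> u x = G x + c"
    by eventually_elim (auto simp: h_def)
  have "ac_deriv (\<lambda>x. G x + c) v" unfolding ac_deriv_def using v G0 by (simp add: G_def)
  then show thesis using ae by (rule that)
qed

section \<open>Boundary value and weak derivative of functions in \<open>H1_halfline\<close>\<close>

lemma L2_halfline_integrable:
  assumes "v \<in> L2_halfline"
  shows "set_integrable lebesgue {0..R} v"
proof -
  have m: "set_borel_measurable lebesgue {0<..} v"
    and i: "set_integrable lebesgue {0<..} (\<lambda>x. \<bar>v x\<bar>\<^sup>2)"
    using assms by (auto simp: L2_halfline_def)
  have "set_integrable lebesgue {0<..R} v"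
  proof (rule set_integrable_bound)
    have "set_integrable lebesgue {0<..R} (\<lambda>x. 1::real)"
      unfolding halfline_closed_open
      by (intro absolutely_integrable_continuous_real continuous_intros)
    moreover have "set_integrable lebesgue {0<..R} (\<lambda>x. \<bar>v x\<bar>\<^sup>2)"
      using i by (rule set_integrable_subset) auto
    ultimately show "set_integrable lebesgue {0<..R} (\<lambda>x. 1 + \<bar>v x\<bar>\<^sup>2)" by (rule set_integral_add)
    show "set_borel_measurable lebesgue {0<..R} v"
      by (rule set_borel_measurable_subset[OF m]) auto
    have "\<bar>y\<bar> \<le> 1 + \<bar>y\<bar>\<^sup>2" for y :: real
      using sum_power2_ge_zero[of "\<bar>y\<bar> - 1" 0] zero_le_power2[of "\<bar>y\<bar>"]
      by (simp add: power2_eq_square algebra_simps)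
    then show "AE x in lebesgue. x \<in> {0<..R} \<longrightarrow> norm (v x) \<le> norm (1 + \<bar>v x\<bar>\<^sup>2)"
      by (intro AE_I2) simp
  qed
  then show ?thesis by (simp add: halfline_closed_open)
qed

text \<open>If the values at 0 differed, the functions would differ on a whole interval
  \<open>{0<..<d}\<close>, which has positive measure. Thus the boundary value does not depend on
  the representative chosen.\<close>

lemma continuous_AE_eq_at_0:
  fixes f g :: "real \<Rightarrow> real"
  assumes "continuous_on {0..} f" "continuous_on {0..} g" "AE x in lebesgue. x > 0 \<longrightarrow> f x = g x"
  shows "f 0 = g 0"
proof (rule ccontr)
  assume ne: "f 0 \<noteq> g 0"
  have "continuous_on {0..} (\<lambda>x. f x - g x)" using assms by (intro continuous_intros)
  then have "\<exists>d>0. \<forall>x\<in>{0..}. dist x 0 < d \<longrightarrow> dist (f x - g x) (f 0 - g 0) < \<bar>f 0 - g 0\<bar>"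
    using ne unfolding continuous_on_iff by (elim ballE[of _ _ 0] allE[of _ "\<bar>f 0 - g 0\<bar>"]) auto
  then obtain d where d: "d > 0" "\<And>x. x \<ge> 0 \<Longrightarrow> x < d \<Longrightarrow> dist (f x - g x) (f 0 - g 0) < \<bar>f 0 - g 0\<bar>"
    by (auto simp: dist_real_def)
  have "AE x in lebesgue. x \<notin> {0<..<d}"
    using assms(3)
  proof eventually_elim
    case (elim x)
    then show ?case using d(2)[of x] by (auto simp: dist_real_def)
  qed
  then have "{0<..<d} \<in> null_sets lebesgue"
    by (subst AE_iff_null_sets) auto
  then show False using d(1) by (simp add: null_sets_def)
qed

text \<open>Resolves the two choice operators in the energy: \<open>g\<close> is a primitive of the
  chosen weak derivative, its existence justifies the choice of a continuous representative, and
  both have the same value at 0 by \<open>continuous_AE_eq_at_0\<close>.\<close>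

lemma H1_halfline_representative:
  assumes "u \<in> H1_halfline"
  obtains g where "ac_deriv g (weak_derivative u)" "weak_derivative u \<in> L2_halfline"
    "AE x in lebesgue. x > 0 \<longrightarrow> u x = g x" "continuous_representative u 0 = g 0"
proof -
  have u: "u \<in> L2_halfline" and ex: "\<exists>v. v \<in> L2_halfline \<and> has_weak_derivative u v"
    using assms by (auto simp: H1_halfline_def)
  have v: "weak_derivative u \<in> L2_halfline" "has_weak_derivative u (weak_derivative u)"
    using someI_ex[OF ex] by (auto simp: weak_derivative_def)
  obtain g where g: "ac_deriv g (weak_derivative u)" "AE x in lebesgue. x > 0 \<longrightarrow> u x = g x"
    by (rule has_weak_derivative_imp_ac[OF L2_halfline_integrable[OF u] L2_halfline_integrable[OF v(1)] v(2)])
  have cg: "continuous_on {0..} g"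
    by (rule continuous_on_halflineI) (rule ac_deriv_continuous_on[OF g(1)])
  have gu: "AE x in lebesgue. x > 0 \<longrightarrow> g x = u x" using g(2) by eventually_elim auto
  have "continuous_on {0..} g \<and> (AE x in lebesgue. x > 0 \<longrightarrow> g x = u x)" using cg gu by blast
  then have r: "continuous_on {0..} (continuous_representative u)"
     "AE x in lebesgue. x > 0 \<longrightarrow> continuous_representative u x = u x"
    using someI[where P="\<lambda>g. continuous_on {0..} g \<and> (AE x in lebesgue. x > 0 \<longrightarrow> g x = u x)"]
    unfolding continuous_representative_def by blast+
  have "AE x in lebesgue. x > 0 \<longrightarrow> continuous_representative u x = g x"
    using r(2) g(2) by eventually_elim auto
  from continuous_AE_eq_at_0[OF r(1) cg this] show thesis using that g v(1) by blast
qed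

text \<open>The difference of two weak derivatives annihilates every test function. This allows the
  energy of an explicit function to be computed with its classical derivative.\<close>

lemma weak_derivative_AE_unique:
  assumes v: "v \<in> L2_halfline" "has_weak_derivative u v"
  shows "AE x in lebesgue. x > 0 \<longrightarrow> weak_derivative u x = v x"
proof -
  define w where "w = weak_derivative u"
  have w: "w \<in> L2_halfline" "has_weak_derivative u w"
    using someI[where P="\<lambda>v. v \<in> L2_halfline \<and> has_weak_derivative u v"] v
    unfolding w_def weak_derivative_def by blast+
  have "AE x in lebesgue. x > 0 \<longrightarrow> w x - v x = 0"
  proof (rule fundamental_lemma_test_functions)
    show "set_integrable lebesgue {0..R} (\<lambda>x. w x - v x)" for R
      by (intro set_integral_diff L2_halfline_integrable v w)
    fix \<phi> assume \<phi>: "\<phi> \<in> test_functions"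
    have "(LINT x:{0<..}|lebesgue. (w x - v x) * \<phi> x)
        = (LINT x:{0<..}|lebesgue. w x * \<phi> x - v x * \<phi> x)" by (simp add: left_diff_distrib)
    also have "\<dots> = (LINT x:{0<..}|lebesgue. w x * \<phi> x) - (LINT x:{0<..}|lebesgue. v x * \<phi> x)"
      by (intro set_integral_diff test_function_integrable[OF _ \<phi>] L2_halfline_integrable v w)
    finally show "(LINT x:{0<..}|lebesgue. (w x - v x) * \<phi> x) = 0"
      using v(2) w(2) \<phi> by (simp add: has_weak_derivative_def)
  qed
  then show ?thesis unfolding w_def by eventually_elim auto
qed

section \<open>The sharp Gagliardo-Nirenberg inequality by calibration\<close>

lemma continuous_on_set_borel_measurable_lebesgue:
  assumes "continuous_on A f" "A \<in> sets borel"
  shows "set_borel_measurable lebesgue A (f :: real \<Rightarrow> real)"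
  using set_measurable_continuous_on[OF assms(2,1)]
  unfolding set_borel_measurable_def by (intro measurable_completion) simp

lemma set_borel_measurable_times:
  fixes f g :: "'a \<Rightarrow> real"
  assumes "set_borel_measurable M A f" "set_borel_measurable M A g"
  shows "set_borel_measurable M A (\<lambda>x. f x * g x)"
proof -
  have "(\<lambda>x. (indicator A x *\<^sub>R f x) * (indicator A x *\<^sub>R g x)) \<in> borel_measurable M"
    using assms unfolding set_borel_measurable_def by (rule borel_measurable_times)
  moreover have "(\<lambda>x. (indicator A x *\<^sub>R f x) * (indicator A x *\<^sub>R g x)) = (\<lambda>x. indicator A x *\<^sub>R (f x * g x))"
    by (auto simp: indicator_def)
  ultimately show ?thesis by (simp add: set_borel_measurable_def)
qed

lemma continuous_on_halfline_ac:
  "ac_deriv g v \<Longrightarrow> continuous_on {0..} g"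
  by (rule continuous_on_halflineI) (rule ac_deriv_continuous_on)

lemma tendsto_integral_halfline:
  assumes "set_integrable lebesgue {0::real..} f"
  shows "((\<lambda>R. LINT x:{0..R}|lebesgue. f x) \<longlongrightarrow> (LINT x:{0..}|lebesgue. f x :: real)) at_top"
  by (rule tendsto_set_lebesgue_integral_at_top) (use assms in auto)

lemma not_set_integrable_halfline_const:
  "\<not> set_integrable lebesgue {X::real..} (\<lambda>x. 1::real)"
proof
  assume "set_integrable lebesgue {X..} (\<lambda>x. 1::real)"
  then have "integrable lebesgue (indicator {X..} :: real \<Rightarrow> real)" by (simp add: set_integrable_def)
  then have fin: "emeasure lebesgue {X..} < \<infinity>" by (simp add: integrable_indicator_iff)
  then obtain r where r: "emeasure lebesgue {X..} = ennreal r" "r \<ge> 0"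
    by (cases "emeasure lebesgue {X..}") auto
  have "emeasure lebesgue {X..X+(r+1)} \<le> emeasure lebesgue {X..}" by (rule emeasure_mono) auto
  then show False using r by (simp add: ennreal_le_iff)
qed

section \<open>Decay at infinity and calibration for a fixed \<open>g\<close> with derivative
  \<open>v\<close>\<close>

context
  fixes g v :: "real \<Rightarrow> real"
  assumes ac: "ac_deriv g v"
    and vm: "set_borel_measurable lebesgue {0..} v"
    and v2: "set_integrable lebesgue {0..} (\<lambda>x. (v x)\<^sup>2)"
    and g2: "set_integrable lebesgue {0..} (\<lambda>x. (g x)\<^sup>2)"
begin

text \<open>The derivative \<open>2 * g * v\<close> of the square is integrable, so the square has a
  limit at infinity. A positive limit would contradict the integrability of the square
  itself.\<close>

lemma square_limit_0: "((\<lambda>x. (g x)\<^sup>2) \<longlongrightarrow> 0) at_top"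
proof -
  note cg = continuous_on_halfline_ac[OF ac]
  have gm: "set_borel_measurable lebesgue {0..} g"
    using cg by (rule continuous_on_set_borel_measurable_lebesgue) auto
  have gv: "set_integrable lebesgue {0..} (\<lambda>x. g x * v x)"
  proof (rule set_integrable_bound)
    show "set_integrable lebesgue {0..} (\<lambda>x. (v x)\<^sup>2 + (g x)\<^sup>2)"
      using v2 g2 by (rule set_integral_add)
    show "set_borel_measurable lebesgue {0..} (\<lambda>x. g x * v x)"
      using gm vm by (rule set_borel_measurable_times)
    have "\<bar>p * q\<bar> \<le> q\<^sup>2 + p\<^sup>2" for p q :: real
    proof -
      have "2 * (\<bar>p\<bar> * \<bar>q\<bar>) \<le> p\<^sup>2 + q\<^sup>2"
        using zero_le_power2[of "\<bar>p\<bar> - \<bar>q\<bar>"] by (simp add: power2_diff)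
      moreover have "0 \<le> \<bar>p\<bar> * \<bar>q\<bar>" by simp
      ultimately show ?thesis unfolding abs_mult by linarith
    qed
    then show "AE x in lebesgue. x \<in> {0..} \<longrightarrow> norm (g x * v x) \<le> norm ((v x)\<^sup>2 + (g x)\<^sup>2)"
      by (intro AE_I2) simp
  qed
  define L where "L = (g 0)\<^sup>2 + (LINT x:{0..}|lebesgue. 2 * (g x * v x))"
  have "(\<lambda>x. v x * g x + g x * v x) = (\<lambda>x. 2 * (g x * v x))" by (rule ext) simp
  with ac_deriv_mult[OF ac ac] have "ac_deriv (\<lambda>x. (g x)\<^sup>2) (\<lambda>x. 2 * (g x * v x))"
    unfolding power2_eq_square by (simp only:)
  note gR = ac_derivD(2)[OF this]
  have "((\<lambda>R. (g 0)\<^sup>2 + (LINT x:{0..R}|lebesgue. 2 * (g x * v x))) \<longlongrightarrow> L) at_top"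
    unfolding L_def by (intro tendsto_intros tendsto_integral_halfline set_integrable_mult_right gv)
  then have lim: "((\<lambda>R. (g R)\<^sup>2) \<longlongrightarrow> L) at_top"
    by (rule Lim_transform_eventually)
       (rule eventually_mono[OF eventually_ge_at_top[of 0]], rule gR[symmetric])
  have "L = 0"
  proof (rule ccontr)
    assume "L \<noteq> 0"
    moreover have "L \<ge> 0"
      by (rule tendsto_lowerbound[OF lim]) auto
    ultimately have L: "L > 0" by simp
    have "eventually (\<lambda>x. (g x)\<^sup>2 > L/2) at_top"
      using order_tendstoD(1)[OF lim, of "L/2"] L by simp
    then obtain X where X: "\<And>x. x \<ge> X \<Longrightarrow> (g x)\<^sup>2 > L/2" by (auto simp: eventually_at_top_linorder)
    \<comment> \<open>On this tail the square exceeds \<open>L/2\<close>, so the constant 1 is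
      dominated by \<open>2 / L * (g x)\<^sup>2\<close>.\<close>
    have "set_integrable lebesgue {max X 0..} (\<lambda>x. 1::real)"
    proof (rule set_integrable_bound)
      have "set_integrable lebesgue {max X 0..} (\<lambda>x. (g x)\<^sup>2)"
        by (rule set_integrable_subset[OF g2]) auto
      then show "set_integrable lebesgue {max X 0..} (\<lambda>x. 2 / L * (g x)\<^sup>2)"
        by (rule set_integrable_mult_right)
      show "AE x in lebesgue. x \<in> {max X 0..} \<longrightarrow> norm (1::real) \<le> norm (2 / L * (g x)\<^sup>2)"
      proof (intro AE_I2 impI)
        fix x assume "x \<in> {max X 0..}"
        with X[of x] L show "norm (1::real) \<le> norm (2 / L * (g x)\<^sup>2)" by (simp add: field_simps)
      qed
      show "set_borel_measurable lebesgue {max X 0..} (\<lambda>x. 1::real)"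
        by (intro continuous_on_set_borel_measurable_lebesgue continuous_intros) auto
    qed
    then show False using not_set_integrable_halfline_const by blast
  qed
  then show ?thesis using lim by simp
qed

text \<open>The function is bounded, by continuity on a compact interval and by decay beyond it. The
  sixth power is therefore at most a constant times the square.\<close>

lemma sixth_power_integrable: "set_integrable lebesgue {0..} (\<lambda>x. (g x) ^ 6)"
proof -
  note cg = continuous_on_halfline_ac[OF ac]
  have "eventually (\<lambda>x. (g x)\<^sup>2 < 1) at_top" using order_tendstoD(2)[OF square_limit_0, of 1] by simp
  then obtain X where X: "\<And>x. x \<ge> X \<Longrightarrow> (g x)\<^sup>2 < 1" by (auto simp: eventually_at_top_linorder)
  have "compact ((\<lambda>x. (g x)\<^sup>2) ` {0..X})"
    by (intro compact_continuous_image continuous_intros ac_deriv_continuous_on[OF ac]) auto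
  then obtain B where "\<forall>y\<in>(\<lambda>x. (g x)\<^sup>2) ` {0..X}. norm y \<le> B"
    using compact_imp_bounded bounded_iff by blast
  then have "(g x)\<^sup>2 \<le> max B 1" if "x \<ge> 0" for x
    using X[of x] that by (cases "x \<le> X") (auto simp: le_max_iff_disj)
  then have le: "(g x) ^ 6 \<le> (max B 1)\<^sup>2 * (g x)\<^sup>2" if "x \<ge> 0" for x
  proof -
    have "((g x)\<^sup>2)\<^sup>2 \<le> (max B 1)\<^sup>2" using \<open>\<And>x. x \<ge> 0 \<Longrightarrow> (g x)\<^sup>2 \<le> max B 1\<close> that by (intro power_mono) auto
    then have "((g x)\<^sup>2)\<^sup>2 * (g x)\<^sup>2 \<le> (max B 1)\<^sup>2 * (g x)\<^sup>2" by (rule mult_right_mono) simp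
    then show ?thesis by (simp add: power_mult[symmetric] power_add[symmetric])
  qed
  show ?thesis
  proof (rule set_integrable_bound)
    show "set_integrable lebesgue {0..} (\<lambda>x. (max B 1)\<^sup>2 * (g x)\<^sup>2)"
      using g2 by (rule set_integrable_mult_right)
    show "set_borel_measurable lebesgue {0..} (\<lambda>x. g x ^ 6)"
      by (intro continuous_on_set_borel_measurable_lebesgue continuous_intros cg) auto
    show "AE x in lebesgue. x \<in> {0..} \<longrightarrow> norm ((g x) ^ 6) \<le> norm ((max B 1)\<^sup>2 * (g x)\<^sup>2)"
      using le by (intro AE_I2) (simp add: abs_mult zero_le_even_power)
  qed
qed

text \<open>With \<open>M x\<close> the mass of \<open>g\<close> on \<open>{x..}\<close>, the function
  \<open>K = \<beta> tan (4 \<beta> (M - c))\<close> satisfies \<open>K' = - (4 \<beta>\<^sup>2 + 4 K\<^sup>2) g\<^sup>2\<close>, so that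
  \<open>v\<^sup>2 - 4 \<beta>\<^sup>2 g\<^sup>6 - (g\<^sup>4 K)' = (v - 2 g\<^sup>3 K)\<^sup>2\<close>.\<close>
lemma calibration_inequality:
  fixes \<beta> c :: real
  defines "\<mu> \<equiv> LINT x:{0..}|lebesgue. (g x)\<^sup>2"
  assumes \<beta>: "\<beta> > 0" and c: "4 * \<beta> * c < pi / 2" "4 * \<beta> * (\<mu> - c) < pi / 2"
  shows "4 * \<beta>\<^sup>2 * (LINT x:{0..}|lebesgue. (g x) ^ 6) - \<beta> * tan (4 * \<beta> * (\<mu> - c)) * (g 0) ^ 4
    \<le> (LINT x:{0..}|lebesgue. (v x)\<^sup>2)"
proof -
  note cg = continuous_on_halfline_ac[OF ac]
  have cg2: "continuous_on {0..} (\<lambda>x. (g x)\<^sup>2)" by (intro continuous_intros cg)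
  have g2R: "set_integrable lebesgue {0..R} (\<lambda>x. (g x)\<^sup>2)" for R
    by (rule set_integrable_subset[OF g2]) auto
  define M where "M = (\<lambda>x. \<mu> - (LINT t:{0..x}|lebesgue. (g t)\<^sup>2))"
  have M_bounds: "0 \<le> M x" "M x \<le> \<mu>" for x
  proof -
    have "(LINT t:{0..x}|lebesgue. (g t)\<^sup>2) \<le> \<mu>"
      unfolding \<mu>_def set_lebesgue_integral_def
      by (intro integral_mono g2R[unfolded set_integrable_def] g2[unfolded set_integrable_def])
         (auto simp: indicator_def)
    moreover have "0 \<le> (LINT t:{0..x}|lebesgue. (g t)\<^sup>2)"
      unfolding set_lebesgue_integral_def by (intro Bochner_Integration.integral_nonneg) auto
    ultimately show "0 \<le> M x" "M x \<le> \<mu>" by (auto simp: M_def)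
  qed
  have M0: "M 0 = \<mu>"
    unfolding M_def set_lebesgue_integral_eq_integral(2)[OF g2R] by simp
  have M': "(M has_real_derivative - (g x)\<^sup>2) (at x within {0..})" if "x \<ge> 0" for x
  proof -
    have "((\<lambda>x. integral {0..x} (\<lambda>t. (g t)\<^sup>2)) has_real_derivative (g x)\<^sup>2) (at x within {0..x+1})"
      by (rule integral_has_real_derivative) (use that continuous_on_subset[OF cg2] in auto)
    then have "(M has_real_derivative - (g x)\<^sup>2) (at x within {0..x+1})"
      unfolding M_def set_lebesgue_integral_eq_integral(2)[OF g2R]
      by (auto intro!: derivative_eq_intros)
    moreover have "at x within {0..x+1} = at x within {0..}"
      by (rule at_within_nhd[of x "{..<x+1}"]) (use that in auto)
    ultimately show ?thesis by simp
  qed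
  define K where "K = (\<lambda>x. \<beta> * tan (4 * \<beta> * (M x - c)))"
  have arg_bounds: "4 * \<beta> * (0 - c) \<le> 4 * \<beta> * (M x - c)" "4 * \<beta> * (M x - c) \<le> 4 * \<beta> * (\<mu> - c)" for x
    using mult_left_mono[of "0 - c" "M x - c" "4 * \<beta>"] mult_left_mono[of "M x - c" "\<mu> - c" "4 * \<beta>"]
      \<beta> M_bounds[of x] by simp_all
  \<comment> \<open>Since \<open>M\<close> stays between 0 and \<mu>, the two assumptions on
    \<open>c\<close> keep the argument in the branch of the tangent around 0: the first gives the
    lower bound, the second the upper one.\<close>
  have arg: "- (pi / 2) < 4 * \<beta> * (M x - c)" "4 * \<beta> * (M x - c) < pi / 2" for x
    using arg_bounds[of x] c by simp_all
  then have cosnz: "cos (4 * \<beta> * (M x - c)) \<noteq> 0" for x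
    using cos_gt_zero_pi by (metis less_irrefl minus_divide_left)
  have K': "(K has_real_derivative - (4 * \<beta>\<^sup>2 + 4 * (K x)\<^sup>2) * (g x)\<^sup>2) (at x within {0..})"
    if "x \<ge> 0" for x
  proof -
    have eq: "inverse ((cos (4 * \<beta> * (M x - c)))\<^sup>2) = 1 + (tan (4 * \<beta> * (M x - c)))\<^sup>2"
      using tan_sec[OF cosnz[of x]] by (simp add: power_inverse)
    have "((\<lambda>x. 4 * \<beta> * (M x - c)) has_real_derivative 4 * \<beta> * - (g x)\<^sup>2) (at x within {0..})"
      by (auto intro!: derivative_eq_intros M'[OF that])
    from DERIV_cmult[OF DERIV_chain2[OF DERIV_tan[OF cosnz[of x]] this], of \<beta>]
    have "(K has_real_derivative \<beta> * ((1 + (tan (4 * \<beta> * (M x - c)))\<^sup>2) * (4 * \<beta> * - (g x)\<^sup>2))) (at x within {0..})"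
      unfolding eq K_def .
    moreover have "\<beta> * ((1 + (tan (4 * \<beta> * (M x - c)))\<^sup>2) * (4 * \<beta> * - (g x)\<^sup>2))
        = - (4 * \<beta>\<^sup>2 + 4 * (K x)\<^sup>2) * (g x)\<^sup>2"
      unfolding K_def by algebra
    ultimately show ?thesis by simp
  qed
  then have cK: "continuous_on {0..} K"
    by (auto simp: continuous_on_eq_continuous_within intro: DERIV_continuous)
  have "ac_deriv K (\<lambda>x. - (4 * \<beta>\<^sup>2 + 4 * (K x)\<^sup>2) * (g x)\<^sup>2)"
    by (rule ac_derivI_C1[OF K']) (assumption, intro continuous_intros cK cg)
  \<comment> \<open>The function \<open>g\<close> is known only as a primitive of \<open>v\<close>,
    so \<open>g ^ 4 * K\<close> is differentiated as an iterated product.\<close>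
  note acH = ac_deriv_mult[OF ac_deriv_mult[OF ac_deriv_mult[OF ac ac] ac_deriv_mult[OF ac ac]] this]
  define H where "H = (\<lambda>x. g x ^ 4 * K x)"
  define H' where "H' = (\<lambda>x. 4 * g x ^ 3 * v x * K x - (4 * \<beta>\<^sup>2 + 4 * (K x)\<^sup>2) * g x ^ 6)"
  have "H = (\<lambda>x. g x * g x * (g x * g x) * K x)"
    unfolding H_def by (simp add: eval_nat_numeral mult.assoc)
  moreover have "H' = (\<lambda>x. ((v x * g x + g x * v x) * (g x * g x) + g x * g x * (v x * g x + g x * v x)) * K x
      + g x * g x * (g x * g x) * (- (4 * \<beta>\<^sup>2 + 4 * (K x)\<^sup>2) * (g x)\<^sup>2))"
    unfolding H'_def by (rule ext) algebra
  ultimately have acH: "ac_deriv H H'" using acH by simp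
  have g6: "set_integrable lebesgue {0..} (\<lambda>x. (g x) ^ 6)" by (rule sixth_power_integrable)
  define E where "E = (\<lambda>x. (v x)\<^sup>2 - 4 * \<beta>\<^sup>2 * (g x) ^ 6)"
  have E: "set_integrable lebesgue {0..} E"
    unfolding E_def by (intro set_integral_diff v2 set_integrable_mult_right g6)
  have le: "H R - H 0 \<le> (LINT x:{0..R}|lebesgue. E x)" if "R \<ge> 0" for R
  proof -
    have "(LINT x:{0..R}|lebesgue. H' x) \<le> (LINT x:{0..R}|lebesgue. E x)"
    proof (rule set_integral_mono)
      show "set_integrable lebesgue {0..R} H'" by (rule ac_derivD(1)[OF acH that])
      show "set_integrable lebesgue {0..R} E" by (rule set_integrable_subset[OF E]) auto
      fix x
      have "E x - H' x = (v x - 2 * g x ^ 3 * K x)\<^sup>2"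
        unfolding E_def H'_def by algebra
      then show "H' x \<le> E x" using zero_le_power2[of "v x - 2 * g x ^ 3 * K x"] by linarith
    qed
    then show ?thesis using ac_derivD(2)[OF acH that] by linarith
  qed
  \<comment> \<open>Monotonicity of the tangent places \<open>K\<close> between its values for
    \<open>M = 0\<close> and \<open>M = \<mu>\<close>. This boundedness, with the decay of
    \<open>g\<close>, removes the boundary term at infinity.\<close>
  have Kb: "\<bar>K x\<bar> \<le> \<bar>\<beta> * tan (4 * \<beta> * (0 - c))\<bar> + \<bar>\<beta> * tan (4 * \<beta> * (\<mu> - c))\<bar>" for x
  proof -
    have "tan (4 * \<beta> * (0 - c)) \<le> tan (4 * \<beta> * (M x - c))"
      by (rule tan_mono_le) (use arg_bounds[of x] arg[of x] c in simp_all)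
    moreover have "tan (4 * \<beta> * (M x - c)) \<le> tan (4 * \<beta> * (\<mu> - c))"
      by (rule tan_mono_le) (use arg_bounds[of x] arg[of x] c in simp_all)
    ultimately have "\<beta> * tan (4 * \<beta> * (0 - c)) \<le> K x" "K x \<le> \<beta> * tan (4 * \<beta> * (\<mu> - c))"
      using \<beta> unfolding K_def by (intro mult_left_mono; simp)+
    then show ?thesis by linarith
  qed
  have "((\<lambda>x. ((g x)\<^sup>2)\<^sup>2) \<longlongrightarrow> 0\<^sup>2) at_top" by (rule tendsto_power[OF square_limit_0])
  then have "((\<lambda>x. g x ^ 4) \<longlongrightarrow> 0) at_top" by (simp add: power_mult[symmetric])
  then have "((\<lambda>x. g x ^ 4 * (\<bar>\<beta> * tan (4 * \<beta> * (0 - c))\<bar> + \<bar>\<beta> * tan (4 * \<beta> * (\<mu> - c))\<bar>)) \<longlongrightarrow> 0) at_top"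
    by (rule tendsto_mult_left_zero)
  then have "((\<lambda>x. g x ^ 4 * K x) \<longlongrightarrow> 0) at_top"
  proof (rule Lim_null_comparison[rotated], intro always_eventually allI)
    fix x
    show "norm (g x ^ 4 * K x)
        \<le> g x ^ 4 * (\<bar>\<beta> * tan (4 * \<beta> * (0 - c))\<bar> + \<bar>\<beta> * tan (4 * \<beta> * (\<mu> - c))\<bar>)"
      using mult_left_mono[OF Kb[of x], of "g x ^ 4"] by (simp add: abs_mult)
  qed
  then have "((\<lambda>x. H x - H 0) \<longlongrightarrow> 0 - H 0) at_top" unfolding H_def by (intro tendsto_intros)
  then have "0 - H 0 \<le> (LINT x:{0..}|lebesgue. E x)"
    by (rule tendsto_le[OF _ tendsto_integral_halfline[OF E], rotated])
       (use le in \<open>auto intro!: eventually_mono[OF eventually_ge_at_top[of 0]]\<close>)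
  also have "(LINT x:{0..}|lebesgue. E x)
     = (LINT x:{0..}|lebesgue. (v x)\<^sup>2) - 4 * \<beta>\<^sup>2 * (LINT x:{0..}|lebesgue. (g x) ^ 6)"
    unfolding E_def using v2 g6 by simp
  finally show ?thesis by (simp add: H_def K_def M0 mult_ac)
qed

text \<open>Calibration with \<open>c = \<mu>\<close>, where the tangent at 0 is
  \<open>tan 0 = 0\<close>. The condition becomes \<open>\<beta> < pi / (8 * \<mu>)\<close>; since
  the endpoint itself is excluded, the sharp constant is multiplied by \<open>z < 1\<close> and
  reached as \<open>z\<close> tends to 1.\<close>

lemma Gagliardo_Nirenberg_halfline:
  defines "\<mu> \<equiv> LINT x:{0..}|lebesgue. (g x)\<^sup>2"
  assumes \<mu>: "\<mu> > 0"
  shows "pi\<^sup>2 / (16 * \<mu>\<^sup>2) * (LINT x:{0..}|lebesgue. (g x) ^ 6) \<le> (LINT x:{0..}|lebesgue. (v x)\<^sup>2)"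
proof (rule field_le_mult_one_interval)
  fix z :: real assume z: "0 < z" "z < 1"
  \<comment> \<open>The square root makes \<open>4 * \<beta>\<^sup>2\<close> exactly
    \<open>z\<close> times the limiting constant.\<close>
  define \<beta> where "\<beta> = pi / (8 * \<mu>) * sqrt z"
  have "4 * \<beta> * \<mu> = pi / 2 * sqrt z" using \<mu> by (simp add: \<beta>_def)
  also have "\<dots> < pi / 2" using z by simp
  finally have "4 * \<beta>\<^sup>2 * (LINT x:{0..}|lebesgue. (g x) ^ 6) \<le> (LINT x:{0..}|lebesgue. (v x)\<^sup>2)"
    using calibration_inequality[of \<beta> \<mu>, folded \<mu>_def] z \<mu> by (simp add: \<beta>_def)
  moreover have "4 * \<beta>\<^sup>2 = z * (pi\<^sup>2 / (16 * \<mu>\<^sup>2))"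
    using z by (simp add: \<beta>_def power_mult_distrib power_divide)
  ultimately show "z * (pi\<^sup>2 / (16 * \<mu>\<^sup>2) * (LINT x:{0..}|lebesgue. (g x) ^ 6))
      \<le> (LINT x:{0..}|lebesgue. (v x)\<^sup>2)" by (simp add: mult.assoc)
qed

text \<open>As \<open>g 0 = 0\<close> removes the boundary term for every \<open>c\<close>, the
  value \<open>c = \<mu> / 2\<close> may be taken. It balances the two conditions and admits
  \<open>\<beta>\<close> up to \<open>pi / (4 * \<mu>)\<close>, twice the previous bound.\<close>

lemma Gagliardo_Nirenberg_halfline_Dirichlet:
  defines "\<mu> \<equiv> LINT x:{0..}|lebesgue. (g x)\<^sup>2"
  assumes \<mu>: "\<mu> > 0" and "g 0 = 0"
  shows "pi\<^sup>2 / (4 * \<mu>\<^sup>2) * (LINT x:{0..}|lebesgue. (g x) ^ 6) \<le> (LINT x:{0..}|lebesgue. (v x)\<^sup>2)"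
proof (rule field_le_mult_one_interval)
  fix z :: real assume z: "0 < z" "z < 1"
  define \<beta> where "\<beta> = pi / (4 * \<mu>) * sqrt z"
  have "4 * \<beta> * (\<mu> / 2) = pi / 2 * sqrt z" using \<mu> by (simp add: \<beta>_def)
  also have "\<dots> < pi / 2" using z by simp
  finally have "4 * \<beta>\<^sup>2 * (LINT x:{0..}|lebesgue. (g x) ^ 6) \<le> (LINT x:{0..}|lebesgue. (v x)\<^sup>2)"
    using calibration_inequality[of \<beta> "\<mu> / 2", folded \<mu>_def] z \<mu> \<open>g 0 = 0\<close> by (simp add: \<beta>_def)
  moreover have "4 * \<beta>\<^sup>2 = z * (pi\<^sup>2 / (4 * \<mu>\<^sup>2))"
    using z by (simp add: \<beta>_def power_mult_distrib power_divide)
  ultimately show "z * (pi\<^sup>2 / (4 * \<mu>\<^sup>2) * (LINT x:{0..}|lebesgue. (g x) ^ 6))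
      \<le> (LINT x:{0..}|lebesgue. (v x)\<^sup>2)" by (simp add: mult.assoc)
qed

end

section \<open>Ground state energy\<close>

lemma set_borel_measurable_compose:
  fixes f h :: "real \<Rightarrow> real"
  assumes f: "set_borel_measurable lebesgue A f" and h: "h \<in> borel_measurable borel"
    and A: "A \<in> sets lebesgue"
  shows "set_borel_measurable lebesgue A (\<lambda>x. h (f x))"
proof -
  \<comment> \<open>The inner indicator makes \<open>f\<close> measurable on the whole line; the
    outer one removes the value \<open>h 0\<close> taken off \<open>A\<close>.\<close>
  have "(\<lambda>x. indicator A x *\<^sub>R h (indicator A x *\<^sub>R f x)) \<in> borel_measurable lebesgue"
    using measurable_compose[OF f[unfolded set_borel_measurable_def] h] A
    by (intro borel_measurable_scaleR borel_measurable_indicator) auto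
  moreover have "(\<lambda>x. indicator A x *\<^sub>R h (indicator A x *\<^sub>R f x)) = (\<lambda>x. indicator A x *\<^sub>R h (f x))"
    by (auto simp: indicator_def)
  ultimately show ?thesis by (simp add: set_borel_measurable_def)
qed

lemma halfline_integral_cong_AE:
  fixes f g :: "real \<Rightarrow> real"
  assumes f: "set_borel_measurable lebesgue {0<..} f" and ae: "AE x in lebesgue. x > 0 \<longrightarrow> f x = g x"
  shows "set_borel_measurable lebesgue {0..} g"
    "set_integrable lebesgue {0<..} f \<longleftrightarrow> set_integrable lebesgue {0..} g"
    "(LINT x:{0<..}|lebesgue. f x) = (LINT x:{0..}|lebesgue. g x)"
proof -
  have "AE x in lebesgue. x \<noteq> (0::real)" by (rule AE_completion) (rule AE_lborel_singleton)
  with ae have ae': "AE x in lebesgue. indicator {0<..} x *\<^sub>R f x = indicator {0..} x *\<^sub>R g x"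
    by eventually_elim (auto simp: indicator_def)
  have f': "(\<lambda>x. indicator {0<..} x *\<^sub>R f x) \<in> borel_measurable lebesgue"
    using f by (simp add: set_borel_measurable_def)
  have g': "(\<lambda>x. indicator {0..} x *\<^sub>R g x) \<in> borel_measurable lebesgue"
    by (rule borel_measurable_AE[OF f' ae'])
  then show "set_borel_measurable lebesgue {0..} g" by (simp add: set_borel_measurable_def)
  show "set_integrable lebesgue {0<..} f \<longleftrightarrow> set_integrable lebesgue {0..} g"
    unfolding set_integrable_def by (rule integrable_cong_AE[OF f' g' ae'])
  show "(LINT x:{0<..}|lebesgue. f x) = (LINT x:{0..}|lebesgue. g x)"
    unfolding set_lebesgue_integral_def by (rule integral_cong_AE[OF f' g' ae'])
qed

lemma L2_halfline_AE_eq: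
  assumes u: "u \<in> L2_halfline" and ae: "AE x in lebesgue. x > 0 \<longrightarrow> u x = g x"
  shows "set_borel_measurable lebesgue {0..} g" "set_integrable lebesgue {0..} (\<lambda>x. (g x)\<^sup>2)"
    "(LINT x:{0<..}|lebesgue. \<bar>u x\<bar>\<^sup>2) = (LINT x:{0..}|lebesgue. (g x)\<^sup>2)"
    "(LINT x:{0<..}|lebesgue. \<bar>u x\<bar> powr 6) = (LINT x:{0..}|lebesgue. g x ^ 6)"
proof -
  have m: "set_borel_measurable lebesgue {0<..} u"
    and i: "set_integrable lebesgue {0<..} (\<lambda>x. \<bar>u x\<bar>\<^sup>2)" using u by (auto simp: L2_halfline_def)
  show "set_borel_measurable lebesgue {0..} g" by (rule halfline_integral_cong_AE(1)[OF m ae])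
  have m2: "set_borel_measurable lebesgue {0<..} (\<lambda>x. \<bar>u x\<bar>\<^sup>2)"
    by (rule set_borel_measurable_compose[OF m]) auto
  have ae2: "AE x in lebesgue. x > 0 \<longrightarrow> \<bar>u x\<bar>\<^sup>2 = (g x)\<^sup>2" using ae by eventually_elim auto
  show "set_integrable lebesgue {0..} (\<lambda>x. (g x)\<^sup>2)"
    "(LINT x:{0<..}|lebesgue. \<bar>u x\<bar>\<^sup>2) = (LINT x:{0..}|lebesgue. (g x)\<^sup>2)"
    using halfline_integral_cong_AE(2,3)[OF m2 ae2] i by auto
  have m6: "set_borel_measurable lebesgue {0<..} (\<lambda>x. \<bar>u x\<bar> powr 6)"
    by (rule set_borel_measurable_compose[OF m]) auto
  have ae6: "AE x in lebesgue. x > 0 \<longrightarrow> \<bar>u x\<bar> powr 6 = g x ^ 6"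
    using ae by eventually_elim (auto simp: power_even_abs)
  show "(LINT x:{0<..}|lebesgue. \<bar>u x\<bar> powr 6) = (LINT x:{0..}|lebesgue. g x ^ 6)"
    by (rule halfline_integral_cong_AE(3)[OF m6 ae6])
qed

text \<open>Translates an arbitrary admissible function into the setting of the calibration
  inequality; \<open>energy_of_ac\<close> below goes the other way, for explicit
  competitors.\<close>

lemma H1_mass_representative:
  assumes "u \<in> H1_mass \<mu>"
  obtains g v where "ac_deriv g v" "set_borel_measurable lebesgue {0..} v"
    "set_integrable lebesgue {0..} (\<lambda>x. (v x)\<^sup>2)" "set_integrable lebesgue {0..} (\<lambda>x. (g x)\<^sup>2)"
    "(LINT x:{0..}|lebesgue. (g x)\<^sup>2) = \<mu>"
    "\<And>\<alpha>. energy 6 \<alpha> u = 1/2 * (LINT x:{0..}|lebesgue. (v x)\<^sup>2)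
       - 1/6 * (LINT x:{0..}|lebesgue. g x ^ 6) + \<alpha>/2 * (g 0)\<^sup>2"
proof -
  have u: "u \<in> H1_halfline" "u \<in> L2_halfline" "(LINT x:{0<..}|lebesgue. \<bar>u x\<bar>\<^sup>2) = \<mu>"
    using assms by (auto simp: H1_mass_def H1_halfline_def)
  obtain g where g: "ac_deriv g (weak_derivative u)" "weak_derivative u \<in> L2_halfline"
    "AE x in lebesgue. x > 0 \<longrightarrow> u x = g x" "continuous_representative u 0 = g 0"
    by (rule H1_halfline_representative[OF u(1)])
  have refl: "AE x in lebesgue. x > 0 \<longrightarrow> weak_derivative u x = weak_derivative u x" by simp
  note G = L2_halfline_AE_eq[OF u(2) g(3)] and V = L2_halfline_AE_eq[OF g(2) refl]
  show thesis
  proof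
    show "energy 6 \<alpha> u = 1/2 * (LINT x:{0..}|lebesgue. (weak_derivative u x)\<^sup>2)
       - 1/6 * (LINT x:{0..}|lebesgue. g x ^ 6) + \<alpha>/2 * (g 0)\<^sup>2" for \<alpha>
      unfolding energy_def V(3) G(4) g(4) by simp
    show "(LINT x:{0..}|lebesgue. (g x)\<^sup>2) = \<mu>" using G(3) u(3) by simp
  qed (use g G V in auto)
qed

lemma energy_of_ac:
  assumes ac: "ac_deriv g v" and g: "g \<in> L2_halfline" and v: "v \<in> L2_halfline"
  shows "g \<in> H1_mass (LINT x:{0..}|lebesgue. (g x)\<^sup>2)"
    "energy 6 \<alpha> g = 1/2 * (LINT x:{0..}|lebesgue. (v x)\<^sup>2)
       - 1/6 * (LINT x:{0..}|lebesgue. g x ^ 6) + \<alpha>/2 * (g 0)\<^sup>2"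
proof -
  have weak: "has_weak_derivative g v" by (rule ac_deriv_imp_weak_derivative[OF ac])
  then have H1: "g \<in> H1_halfline" using g v by (auto simp: H1_halfline_def)
  have refl: "AE x in lebesgue. x > 0 \<longrightarrow> g x = g x" by simp
  note G = L2_halfline_AE_eq[OF g refl]
  show "g \<in> H1_mass (LINT x:{0..}|lebesgue. (g x)\<^sup>2)"
    using H1 G(3) by (simp add: H1_mass_def)
  obtain r where r: "ac_deriv r (weak_derivative g)" "weak_derivative g \<in> L2_halfline"
    "AE x in lebesgue. x > 0 \<longrightarrow> g x = r x" "continuous_representative g 0 = r 0"
    by (rule H1_halfline_representative[OF H1])
  have "g 0 = r 0"
    by (rule continuous_AE_eq_at_0[OF continuous_on_halfline_ac[OF ac] continuous_on_halfline_ac[OF r(1)] r(3)])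
  then show "energy 6 \<alpha> g = 1/2 * (LINT x:{0..}|lebesgue. (v x)\<^sup>2)
       - 1/6 * (LINT x:{0..}|lebesgue. g x ^ 6) + \<alpha>/2 * (g 0)\<^sup>2"
    unfolding energy_def G(4) r(4) L2_halfline_AE_eq(3)[OF r(2) weak_derivative_AE_unique[OF v weak]]
    by simp
qed

section \<open>Positivity of the energy up to the critical mass\<close>

lemma critical_mass_iff:
  assumes "\<mu> > 0"
  shows "\<mu> \<le> sqrt 3 * pi / 4 \<longleftrightarrow> 16 * \<mu>\<^sup>2 \<le> 3 * pi\<^sup>2"
proof -
  have "\<mu> \<le> sqrt 3 * pi / 4 \<longleftrightarrow> \<mu>\<^sup>2 \<le> (sqrt 3 * pi / 4)\<^sup>2"
    using assms by (simp add: power2_le_iff_abs_le)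
  also have "(sqrt 3 * pi / 4)\<^sup>2 = 3 * pi\<^sup>2 / 16" by (simp add: power_mult_distrib power_divide)
  also have "\<mu>\<^sup>2 \<le> 3 * pi\<^sup>2 / 16 \<longleftrightarrow> 16 * \<mu>\<^sup>2 \<le> 3 * pi\<^sup>2" by auto
  finally show ?thesis .
qed

text \<open>Strict positivity, including at the critical mass, serves twice: it bounds the infimum
  from below by 0 and prevents that value from being attained.\<close>

lemma energy_pos:
  assumes \<alpha>: "\<alpha> > 0" and \<mu>: "0 < \<mu>" "\<mu> \<le> sqrt 3 * pi / 4" and u: "u \<in> H1_mass \<mu>"
  shows "energy 6 \<alpha> u > 0"
proof -
  obtain g v where gv: "ac_deriv g v" "set_borel_measurable lebesgue {0..} v"
    "set_integrable lebesgue {0..} (\<lambda>x. (v x)\<^sup>2)" "set_integrable lebesgue {0..} (\<lambda>x. (g x)\<^sup>2)"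
    and mass: "(LINT x:{0..}|lebesgue. (g x)\<^sup>2) = \<mu>"
    and E: "\<And>\<alpha>. energy 6 \<alpha> u = 1/2 * (LINT x:{0..}|lebesgue. (v x)\<^sup>2)
       - 1/6 * (LINT x:{0..}|lebesgue. g x ^ 6) + \<alpha>/2 * (g 0)\<^sup>2"
    by (rule H1_mass_representative[OF u]) blast
  define Iv where "Iv = (LINT x:{0..}|lebesgue. (v x)\<^sup>2)"
  define I6 where "I6 = (LINT x:{0..}|lebesgue. g x ^ 6)"
  have g6: "set_integrable lebesgue {0..} (\<lambda>x. g x ^ 6)" by (rule sixth_power_integrable[OF gv])
  have "I6 \<ge> 0" unfolding I6_def set_lebesgue_integral_def
    by (intro Bochner_Integration.integral_nonneg) (auto simp: zero_le_even_power)
  \<comment> \<open>A vanishing sixth-power integral would force \<open>g = 0\<close> almost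
    everywhere, against the positive mass.\<close>
  have "I6 \<noteq> 0"
  proof
    assume "I6 = 0"
    then have "AE x in lebesgue. indicator {0..} x *\<^sub>R g x ^ 6 = 0"
      using integral_nonneg_eq_0_iff_AE[OF g6[unfolded set_integrable_def]]
      by (simp add: I6_def set_lebesgue_integral_def zero_le_even_power)
    then have "AE x in lebesgue. indicator {0..} x *\<^sub>R (g x)\<^sup>2 = 0"
      by eventually_elim (auto simp: indicator_def split: if_splits)
    then have "(LINT x:{0..}|lebesgue. (g x)\<^sup>2) = 0"
      unfolding set_lebesgue_integral_def by (rule integral_eq_zero_AE)
    then show False using mass \<mu> by simp
  qed
  with \<open>I6 \<ge> 0\<close> have I6: "I6 > 0" by simp
  have crit: "16 * \<mu>\<^sup>2 \<le> 3 * pi\<^sup>2" using critical_mass_iff \<mu> by blast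
  \<comment> \<open>The threshold \<open>1/3\<close> is the ratio of the coefficients
    \<open>1/6\<close> and \<open>1/2\<close> in the energy.\<close>
  then have c: "1 / 3 \<le> pi\<^sup>2 / (16 * \<mu>\<^sup>2)" using \<mu> by (simp add: field_simps)
  show ?thesis
  proof (cases "g 0 = 0")
    case True
    have "4 * (pi\<^sup>2 / (16 * \<mu>\<^sup>2)) * I6 \<le> Iv"
      using Gagliardo_Nirenberg_halfline_Dirichlet[OF gv] mass \<mu> True by (simp add: I6_def Iv_def)
    moreover have "4 * (1 / 3) * I6 \<le> 4 * (pi\<^sup>2 / (16 * \<mu>\<^sup>2)) * I6"
      using c I6 by (intro mult_right_mono mult_left_mono) auto
    ultimately have "4 / 3 * I6 \<le> Iv" by simp
    then show ?thesis using E[of \<alpha>, folded Iv_def I6_def] I6 True by simp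
  next
    case False
    have "pi\<^sup>2 / (16 * \<mu>\<^sup>2) * I6 \<le> Iv"
      using Gagliardo_Nirenberg_halfline[OF gv] mass \<mu> by (simp add: I6_def Iv_def)
    moreover have "1 / 3 * I6 \<le> pi\<^sup>2 / (16 * \<mu>\<^sup>2) * I6"
      using c I6 by (intro mult_right_mono) auto
    ultimately have "1 / 3 * I6 \<le> Iv" by simp
    moreover have "\<alpha> / 2 * (g 0)\<^sup>2 > 0" using \<alpha> False by simp
    ultimately show ?thesis using E[of \<alpha>, folded Iv_def I6_def] by linarith
  qed
qed

section \<open>Integrals of sech and its cube, and the rescaled solitons\<close>

lemma integral_halfline_FTC_nonneg:
  fixes f F :: "real \<Rightarrow> real"
  assumes f: "\<And>x. (F has_real_derivative f x) (at x)" "\<And>x. 0 \<le> f x" "continuous_on UNIV f"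
    and T: "(F \<longlongrightarrow> T) at_top"
  shows "set_integrable lebesgue {0..} f" "(LINT x:{0..}|lebesgue. f x) = T - F 0"
proof -
  have m: "f \<in> borel_measurable borel" using f(3) by (rule borel_measurable_continuous_onI)
  have F_mono: "F 0 \<le> F x" if "0 \<le> x" for x
    by (rule DERIV_nonneg_imp_nondecreasing[OF that]) (use f in blast)
  have FT: "F 0 \<le> T"
    by (rule tendsto_lowerbound[OF T])
       (use F_mono in \<open>auto intro!: eventually_mono[OF eventually_ge_at_top[of 0]]\<close>)
  \<comment> \<open>For a nonnegative integrand, the finite limit of the primitive yields
    integrability together with the value.\<close>
  have "(\<integral>\<^sup>+x. ennreal (f x) * indicator {0 ..} x \<partial>lborel) = T - F 0"
    by (rule nn_integral_FTC_atLeast[OF m]) (use f T in auto)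
  then have nn: "(\<integral>\<^sup>+x. ennreal (indicator {0..} x *\<^sub>R f x) \<partial>lborel) = T - F 0"
    by (simp add: nn_integral_set_ennreal mult.commute)
  have "has_bochner_integral lborel (\<lambda>x. indicator {0..} x *\<^sub>R f x) (T - F 0)"
    by (rule has_bochner_integral_nn_integral) (use m f FT nn in auto)
  then have "has_bochner_integral lebesgue (\<lambda>x. indicator {0..} x *\<^sub>R f x) (T - F 0)"
    using m by (simp add: has_bochner_integral_iff integrable_completion integral_completion)
  then show "set_integrable lebesgue {0..} f" "(LINT x:{0..}|lebesgue. f x) = T - F 0"
    by (auto simp: has_bochner_integral_iff set_integrable_def set_lebesgue_integral_def)
qed

lemma sinh_times_at_top: "k > 0 \<Longrightarrow> filterlim (\<lambda>x. sinh (k * x)) at_top at_top" for k :: real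
  by (rule filterlim_compose[OF sinh_real_at_top])
     (rule filterlim_tendsto_pos_mult_at_top[OF tendsto_const _ filterlim_ident])

lemma cosh_times_at_top: "k > 0 \<Longrightarrow> filterlim (\<lambda>x. cosh (k * x)) at_top at_top" for k :: real
  by (rule filterlim_compose[OF cosh_real_at_top])
     (rule filterlim_tendsto_pos_mult_at_top[OF tendsto_const _ filterlim_ident])

text \<open>\<open>arctan (sinh y)\<close> is the Gudermannian function, the standard primitive of
  \<open>1 / cosh y\<close>.\<close>

lemma arctan_sinh_derivative:
  "((\<lambda>x. arctan (sinh (k * x))) has_real_derivative k / cosh (k * x)) (at x)" for k :: real
proof -
  have nz: "cosh (k * x) \<noteq> 0" by simp
  have "((\<lambda>x. arctan (sinh (k * x))) has_real_derivative inverse (1 + (sinh (k * x))\<^sup>2) * (cosh (k * x) * k)) (at x)"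
    by (auto intro!: derivative_eq_intros)
  moreover have "inverse (1 + (sinh (k * x))\<^sup>2) * (cosh (k * x) * k) = k / cosh (k * x)"
    using nz unfolding add.commute[of 1] cosh_square_eq[symmetric] by (simp add: field_simps power2_eq_square)
  ultimately show ?thesis by simp
qed

lemma integral_sech:
  fixes k :: real
  assumes k: "k > 0"
  shows "set_integrable lebesgue {0..} (\<lambda>x. 1 / cosh (k * x))"
    "(LINT x:{0..}|lebesgue. 1 / cosh (k * x)) = pi / (2 * k)"
proof -
  have d: "((\<lambda>x. arctan (sinh (k * x)) / k) has_real_derivative 1 / cosh (k * x)) (at x)" for x
    using DERIV_cdivide[OF arctan_sinh_derivative[of k x], of k] k by simp
  have l: "((\<lambda>x. arctan (sinh (k * x)) / k) \<longlongrightarrow> (pi / 2) / k) at_top"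
    by (intro tendsto_divide tendsto_const filterlim_compose[OF tendsto_arctan_at_top sinh_times_at_top[OF k]])
       (use k in auto)
  have c: "continuous_on UNIV (\<lambda>x. 1 / cosh (k * x))" by (intro continuous_intros) auto
  show "set_integrable lebesgue {0..} (\<lambda>x. 1 / cosh (k * x))"
    by (rule integral_halfline_FTC_nonneg(1)[OF d _ c l]) simp
  show "(LINT x:{0..}|lebesgue. 1 / cosh (k * x)) = pi / (2 * k)"
    by (subst integral_halfline_FTC_nonneg(2)[OF d _ c l]) auto
qed

lemma integral_sech_cubed:
  fixes k :: real
  assumes k: "k > 0"
  shows "set_integrable lebesgue {0..} (\<lambda>x. 1 / cosh (k * x) ^ 3)"
    "(LINT x:{0..}|lebesgue. 1 / cosh (k * x) ^ 3) = pi / (4 * k)"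
proof -
  \<comment> \<open>The reduction formula for the cube of sech: half of sech times tanh plus half of
    a primitive of sech.\<close>
  define F where "F = (\<lambda>x. (sinh (k * x) / (cosh (k * x))\<^sup>2 + arctan (sinh (k * x))) / (2 * k))"
  have d: "(F has_real_derivative 1 / cosh (k * x) ^ 3) (at x)" for x
  proof -
    define s where "s = sinh (k * x)"
    define c where "c = cosh (k * x)"
    have c: "c > 0" "c\<^sup>2 = s\<^sup>2 + 1" unfolding c_def s_def by (simp_all add: cosh_square_eq)
    have "((\<lambda>x. sinh (k * x) / (cosh (k * x))\<^sup>2) has_real_derivative
        (c * k * c\<^sup>2 - s * (2 * c * (s * k))) / (c\<^sup>2 * c\<^sup>2)) (at x)"
      unfolding c_def s_def by (auto intro!: derivative_eq_intros simp: power2_eq_square)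
    from DERIV_cdivide[OF DERIV_add[OF this arctan_sinh_derivative[of k x]], of "2 * k"]
    have "(F has_real_derivative ((c * k * c\<^sup>2 - s * (2 * c * (s * k))) / (c\<^sup>2 * c\<^sup>2) + k / c) / (2 * k)) (at x)"
      unfolding F_def c_def .
    moreover have "((c * k * c\<^sup>2 - s * (2 * c * (s * k))) / (c\<^sup>2 * c\<^sup>2) + k / c) / (2 * k) = 1 / c ^ 3"
    proof -
      have s2: "s\<^sup>2 = c\<^sup>2 - 1" using c by simp
      have num: "c * k * c\<^sup>2 - s * (2 * c * (s * k)) = c * k * (2 - c\<^sup>2)"
        using s2 by algebra
      show ?thesis unfolding num using c(1) k by (simp add: field_simps power2_eq_square eval_nat_numeral)
    qed
    ultimately show ?thesis by (simp add: c_def)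
  qed
  have "((\<lambda>x. sinh (k * x) / (cosh (k * x))\<^sup>2) \<longlongrightarrow> 0) at_top"
  proof (rule Lim_null_comparison)
    show "((\<lambda>x. 1 / cosh (k * x)) \<longlongrightarrow> 0) at_top"
      by (intro tendsto_divide_0[OF tendsto_const] filterlim_at_top_imp_at_infinity cosh_times_at_top k)
    show "\<forall>\<^sub>F x in at_top. norm (sinh (k * x) / (cosh (k * x))\<^sup>2) \<le> 1 / cosh (k * x)"
    proof (rule always_eventually, rule allI)
      fix x
      have "\<bar>sinh (k * x)\<bar> \<le> cosh (k * x)"
        by (rule abs_le_square_iff[THEN iffD2, of _ "cosh (k * x)", simplified])
           (simp add: cosh_square_eq)
      then show "norm (sinh (k * x) / (cosh (k * x))\<^sup>2) \<le> 1 / cosh (k * x)"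
        by (simp add: field_simps power2_eq_square)
    qed
  qed
  moreover have "((\<lambda>x. arctan (sinh (k * x))) \<longlongrightarrow> pi / 2) at_top"
    by (rule filterlim_compose[OF tendsto_arctan_at_top sinh_times_at_top[OF k]])
  ultimately have l: "(F \<longlongrightarrow> (0 + pi / 2) / (2 * k)) at_top"
    unfolding F_def by (intro tendsto_divide tendsto_const tendsto_add) (use k in auto)
  have c: "continuous_on UNIV (\<lambda>x. 1 / cosh (k * x) ^ 3)" by (intro continuous_intros) auto
  show "set_integrable lebesgue {0..} (\<lambda>x. 1 / cosh (k * x) ^ 3)"
    by (rule integral_halfline_FTC_nonneg(1)[OF d _ c l]) simp
  show "(LINT x:{0..}|lebesgue. 1 / cosh (k * x) ^ 3) = pi / (4 * k)"
    by (subst integral_halfline_FTC_nonneg(2)[OF d _ c l]) (auto simp: F_def)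
qed

text \<open>These profiles give equality in \<open>Gagliardo_Nirenberg_halfline\<close>. At fixed
  mass the kinetic and the sextic integral both scale like \<open>k\<^sup>2\<close>, which reflects
  the criticality of the exponent 6, while the squared boundary value scales like
  \<open>k\<close>.\<close>

lemma soliton_competitor:
  fixes k \<mu> \<alpha> :: real
  assumes k: "k > 0" and \<mu>: "\<mu> > 0"
  obtains u where "u \<in> H1_mass \<mu>"
    "energy 6 \<alpha> u = k\<^sup>2 * (\<mu> / 16 - \<mu> ^ 3 / (3 * pi\<^sup>2)) + k * (\<alpha> * \<mu> / pi)"
proof -
  \<comment> \<open>The amplitude solves \<open>A\<^sup>2 * (pi / (2 * k)) = \<mu>\<close>, so that
    the mass is \<mu>.\<close>
  define A where "A = sqrt (2 * k * \<mu> / pi)"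
  have A2: "A\<^sup>2 = 2 * k * \<mu> / pi" using k \<mu> by (simp add: A_def)
  define C where "C = (\<lambda>x. cosh (k * x))"
  have C: "C x > 0" for x by (simp add: C_def)
  have cC: "continuous_on UNIV C" unfolding C_def by (intro continuous_intros)
  define g where "g = (\<lambda>x. A / sqrt (C x))"
  define v where "v = (\<lambda>x. - (A * k / 2) * sinh (k * x) / (C x * sqrt (C x)))"
  have gv: "(g has_real_derivative v x) (at x)" for x
  proof -
    have 1: "(C has_real_derivative sinh (k * x) * k) (at x)"
      unfolding C_def by (auto intro!: derivative_eq_intros)
    have "((\<lambda>x. sqrt (C x)) has_real_derivative inverse (sqrt (C x)) / 2 * (sinh (k * x) * k)) (at x)"
      by (rule DERIV_chain2[OF DERIV_real_sqrt[OF C] 1])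
    from DERIV_divide[OF DERIV_const[of A] this]
    have "(g has_real_derivative (0 * sqrt (C x) - A * (inverse (sqrt (C x)) / 2 * (sinh (k * x) * k)))
        / (sqrt (C x) * sqrt (C x))) (at x)"
      unfolding g_def using C[of x] by simp
    moreover have "(0 * sqrt (C x) - A * (inverse (sqrt (C x)) / 2 * (sinh (k * x) * k)))
        / (sqrt (C x) * sqrt (C x)) = v x"
      using C[of x] by (simp add: v_def field_simps)
    ultimately show ?thesis by simp
  qed
  have cg: "continuous_on UNIV g" unfolding g_def using C by (intro continuous_intros cC) (auto simp: less_imp_neq[symmetric])
  have cv: "continuous_on UNIV v" unfolding v_def using C by (intro continuous_intros cC) (auto simp: less_imp_neq[symmetric])
  have ac: "ac_deriv g v"
    by (rule ac_derivI_C1) (use gv cv DERIV_subset continuous_on_subset in \<open>blast+\<close>)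
  have g2: "(g x)\<^sup>2 = A\<^sup>2 * (1 / C x)" for x
    using C[of x] by (simp add: g_def power_divide)
  have g6: "g x ^ 6 = A ^ 6 * (1 / C x ^ 3)" for x
  proof -
    have "g x ^ 6 = ((g x)\<^sup>2) ^ 3" by (simp flip: power_mult)
    also have "\<dots> = A ^ 6 * (1 / C x ^ 3)" unfolding g2 power_mult_distrib power_divide by (simp flip: power_mult)
    finally show ?thesis .
  qed
  \<comment> \<open>Replacing the square of sinh by that of cosh minus 1 reduces the kinetic term to
    the two integrals already computed.\<close>
  have v2: "(v x)\<^sup>2 = A\<^sup>2 * k\<^sup>2 / 4 * (1 / C x - 1 / C x ^ 3)" for x
  proof -
    have s: "(sinh (k * x))\<^sup>2 = (C x)\<^sup>2 - 1" by (simp add: C_def cosh_square_eq)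
    have "(v x)\<^sup>2 = A\<^sup>2 * k\<^sup>2 / 4 * (sinh (k * x))\<^sup>2 / ((C x)\<^sup>2 * C x)"
      using C[of x] by (simp add: v_def power_divide power_mult_distrib)
    also have "\<dots> = A\<^sup>2 * k\<^sup>2 / 4 * (((C x)\<^sup>2 - 1) / ((C x)\<^sup>2 * C x))" unfolding s by simp
    also have "((C x)\<^sup>2 - 1) / ((C x)\<^sup>2 * C x) = 1 / C x - 1 / C x ^ 3"
      using C[of x] by (simp add: field_simps eval_nat_numeral)
    finally show ?thesis .
  qed
  have S1: "set_integrable lebesgue {0..} (\<lambda>x. 1 / C x)" "(LINT x:{0..}|lebesgue. 1 / C x) = pi / (2 * k)"
    and S3: "set_integrable lebesgue {0..} (\<lambda>x. 1 / C x ^ 3)" "(LINT x:{0..}|lebesgue. 1 / C x ^ 3) = pi / (4 * k)"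
    using integral_sech[OF k] integral_sech_cubed[OF k] unfolding C_def by blast+
  have L2: "f \<in> L2_halfline"
    if "continuous_on UNIV f" "set_integrable lebesgue {0..} (\<lambda>x. (f x)\<^sup>2)" for f
    unfolding L2_halfline_def using that
    by (auto simp: halfline_closed_open intro!: continuous_on_set_borel_measurable_lebesgue
        intro: continuous_on_subset)
  have gL: "g \<in> L2_halfline"
    by (rule L2[OF cg]) (unfold g2, intro set_integrable_mult_right S1)
  have vL: "v \<in> L2_halfline"
    by (rule L2[OF cv]) (unfold v2, intro set_integrable_mult_right set_integral_diff S1 S3)
  have "(LINT x:{0..}|lebesgue. (g x)\<^sup>2) = A\<^sup>2 * (pi / (2 * k))"
    unfolding g2 set_integral_mult_right S1(2) ..
  also have "\<dots> = \<mu>" unfolding A2 using k by simp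
  finally have mass: "(LINT x:{0..}|lebesgue. (g x)\<^sup>2) = \<mu>" .
  have "(LINT x:{0..}|lebesgue. (v x)\<^sup>2) = A\<^sup>2 * k\<^sup>2 / 4 * (pi / (2 * k) - pi / (4 * k))"
    unfolding v2 set_integral_mult_right using S1 S3 by (simp only: set_integral_diff)
  also have "\<dots> = k\<^sup>2 * \<mu> / 8" unfolding A2 using k by (simp add: field_simps power2_eq_square)
  finally have Iv: "(LINT x:{0..}|lebesgue. (v x)\<^sup>2) = k\<^sup>2 * \<mu> / 8" .
  have "(LINT x:{0..}|lebesgue. g x ^ 6) = (A\<^sup>2) ^ 3 * (pi / (4 * k))"
    unfolding g6 set_integral_mult_right S3(2) by (simp flip: power_mult)
  also have "\<dots> = 2 * k\<^sup>2 * \<mu> ^ 3 / pi\<^sup>2"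
    unfolding A2 using k by (simp add: field_simps eval_nat_numeral)
  finally have I6: "(LINT x:{0..}|lebesgue. g x ^ 6) = 2 * k\<^sup>2 * \<mu> ^ 3 / pi\<^sup>2" .
  have g0: "(g 0)\<^sup>2 = 2 * k * \<mu> / pi" unfolding g2 A2 by (simp add: C_def)
  show thesis
  proof
    show "g \<in> H1_mass \<mu>" using energy_of_ac(1)[OF ac gL vL] mass by simp
    show "energy 6 \<alpha> g = k\<^sup>2 * (\<mu> / 16 - \<mu> ^ 3 / (3 * pi\<^sup>2)) + k * (\<alpha> * \<mu> / pi)"
      unfolding energy_of_ac(2)[OF ac gL vL] Iv I6 g0 by (simp add: field_simps)
  qed
qed

section \<open>Value of the infimum and nonexistence of ground states\<close>

lemma ground_energy_le:
  assumes "k > 0" "\<mu> > 0"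
  shows "ground_energy 6 \<alpha> \<mu> \<le> ereal (k\<^sup>2 * (\<mu> / 16 - \<mu> ^ 3 / (3 * pi\<^sup>2)) + k * (\<alpha> * \<mu> / pi))"
proof -
  obtain u where u: "u \<in> H1_mass \<mu>"
    "energy 6 \<alpha> u = k\<^sup>2 * (\<mu> / 16 - \<mu> ^ 3 / (3 * pi\<^sup>2)) + k * (\<alpha> * \<mu> / pi)"
    by (rule soliton_competitor[OF assms])
  show ?thesis unfolding ground_energy_def u(2)[symmetric] by (rule INF_lower[OF u(1)])
qed

lemma ground_energy_subcritical:
  assumes \<alpha>: "\<alpha> > 0" and \<mu>: "0 < \<mu>" "\<mu> \<le> sqrt 3 * pi / 4"
  shows "ground_energy 6 \<alpha> \<mu> = 0"
proof (rule antisym)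
  show "0 \<le> ground_energy 6 \<alpha> \<mu>"
    unfolding ground_energy_def
    by (rule INF_greatest) (use energy_pos[OF \<alpha> \<mu>] in \<open>simp add: less_imp_le\<close>)
  \<comment> \<open>As \<open>k\<close> decreases to 0 the competitors flatten out and their
    energies tend to 0. The limit is one-sided because the competitors exist for
    \<open>k > 0\<close>.\<close>
  define e where "e = (\<lambda>k::real. k\<^sup>2 * (\<mu> / 16 - \<mu> ^ 3 / (3 * pi\<^sup>2)) + k * (\<alpha> * \<mu> / pi))"
  have "(e \<longlongrightarrow> e 0) (at_right 0)"
    unfolding e_def by (intro tendsto_intros)
  then have "((\<lambda>k. ereal (e k)) \<longlongrightarrow> 0) (at_right 0)" by (simp add: e_def zero_ereal_def)
  then show "ground_energy 6 \<alpha> \<mu> \<le> 0"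
    by (rule tendsto_lowerbound)
       (use ground_energy_le[OF _ \<mu>(1)] in \<open>auto simp: e_def eventually_at_right_less
         intro!: eventually_mono[OF eventually_at_right_less[of 0]]\<close>)
qed

lemma ground_energy_supercritical:
  assumes \<mu>: "0 < \<mu>" "\<not> \<mu> \<le> sqrt 3 * pi / 4"
  shows "ground_energy 6 \<alpha> \<mu> = -\<infinity>"
proof (rule ereal_bot)
  fix B :: real
  define c where "c = \<mu> / 16 - \<mu> ^ 3 / (3 * pi\<^sup>2)"
  define D where "D = \<alpha> * \<mu> / pi"
  have "16 * \<mu>\<^sup>2 > 3 * pi\<^sup>2" using critical_mass_iff[OF \<mu>(1)] \<mu>(2) by simp
  then have "\<mu> * (3 * pi\<^sup>2) < \<mu> * (16 * \<mu>\<^sup>2)" using \<mu>(1) by (intro mult_strict_left_mono)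
  then have c: "c < 0" by (simp add: c_def field_simps eval_nat_numeral)
  \<comment> \<open>The second entry of the maximum forces
    \<open>k * c + D \<le> - \<bar>B\<bar>\<close>; then \<open>k \<ge> 1\<close> keeps the energy
    \<open>k * (k * c + D)\<close> at or below \<open>- \<bar>B\<bar>\<close>, hence below or equal
    to \<open>B\<close>.\<close>
  define k where "k = max 1 ((\<bar>B\<bar> + D) / - c)"
  have k: "k \<ge> 1" "(\<bar>B\<bar> + D) / - c \<le> k" by (auto simp: k_def)
  then have "\<bar>B\<bar> + D \<le> k * - c" using c pos_divide_le_eq[of "- c" "\<bar>B\<bar> + D" k] by simp
  then have "k * c + D \<le> - \<bar>B\<bar>" by simp
  then have "k * (k * c + D) \<le> k * - \<bar>B\<bar>" using k by (intro mult_left_mono) auto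
  also have "\<dots> \<le> 1 * - \<bar>B\<bar>" using k by (intro mult_right_mono_neg) auto
  also have "\<dots> \<le> B" by simp
  finally have "k\<^sup>2 * c + k * D \<le> B" by (simp add: power2_eq_square algebra_simps)
  then show "ground_energy 6 \<alpha> \<mu> \<le> ereal B"
    using ground_energy_le[of k \<mu> \<alpha>, folded c_def D_def] k(1) \<mu>(1)
    by (meson ereal_less_eq(3) less_le_trans order_trans zero_less_one)
qed

theorem theorem1p6:
  fixes p \<alpha> :: real
  assumes "p = 6" and "\<alpha> > 0"
  shows "(\<forall>\<mu>::real. 0 < \<mu> \<longrightarrow>
            ground_energy p \<alpha> \<mu> = (if \<mu> \<le> sqrt 3 * pi / 4 then 0 else -\<infinity>)) \<and>
         (\<forall>\<mu>::real. 0 < \<mu> \<longrightarrow> \<not> (\<exists>u. is_ground_state p \<alpha> \<mu> u))"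
proof -
  have ge: "ground_energy p \<alpha> \<mu> = (if \<mu> \<le> sqrt 3 * pi / 4 then 0 else -\<infinity>)" if "0 < \<mu>" for \<mu>
    using ground_energy_subcritical ground_energy_supercritical assms that by simp
  \<comment> \<open>Up to the critical mass a ground state would have energy 0, against
    \<open>energy_pos\<close>; above it, its real energy would have to equal minus infinity.\<close>
  moreover have False if "0 < \<mu>" "is_ground_state p \<alpha> \<mu> u" for \<mu> u
    using that energy_pos[OF assms(2), of \<mu> u] ge[of \<mu>] assms(1)
    by (auto simp: is_ground_state_def split: if_splits)
  ultimately show ?thesis by blast
qed

end
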